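(* Let $1\le p<\infty$. For each $t\in[0,1)$ both of the bounded operators $C_t\colon H^p\to H^p$ and $S_t\colon H^p\to H^p$ are power bounded, uniformly mean ergodic and fail to be supercyclic.
   Context: Let $\mathbb{D}=\{z\in\mathbb{C}:|z|<1\}$ and let $H(\mathbb{D})$ be the space of holomorphic functions on $\mathbb{D}$. For $1\le p<\infty$ the Hardy space $H^p$ is the Banach space of all $f\in H(\mathbb{D})$ with $\|f\|_p:=\sup_{0\le r<1}\left(\frac{1}{2\pi}\int_0^{2\pi}|f(re^{i\theta})|^p\,d\theta\right)^{1/p}<\infty$. For $t\in[0,1)$ the generalized Cesàro operator $C_t\colon H(\mathbb{D})\to H(\mathbb{D})$ is defined by $(C_tf)(0):=f(0)$ and $(C_tf)(z):=\frac1z\int_0^z\frac{f(\xi)}{1-t\xi}\,d\xi$ for $z\in\mathbb{D}\setminus\{0\}$; it acts continuously on $H^p$. The forward shift $S$ is $(Sf)(z):=zf(z)$, and $S_t:=S\circ C_t$, i.e. $(S_tf)(z)=\int_0^z\frac{f(\xi)}{1-t\xi}\,d\xi$. A bounded linear operator $T$ on a complex Banach space $X$ is power bounded if $\sup_{n\in\mathbb{N}_0}\|T^n\|_{X\to X}<\infty$ (where $\mathbb{N}_0=\{0,1,2,\ldots\}$); uniformly mean ergodic if the Cesàro means $T_{[n]}:=\frac1n\sum_{m=1}^nT^m$, $n\in\mathbb{N}$, converge in the operator norm; and supercyclic if for some $x\in X$ the projective orbit $\{\lambda T^nx:\lambda\in\mathbb{C},\ n\in\mathbb{N}_0\}$ is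 dense in $X$. *)

theory Defs
  imports "HOL-Complex_Analysis.Complex_Analysis"
begin

text \<open>A function on the open unit disc is represented by its extension by zero to the whole plane.
  Thus equality of representatives is equality on the disc, and \<open>hardy_norm p\<close> is a genuine norm
  on \<open>hardy_space p\<close>.\<close>

definition holo_disc :: "(complex \<Rightarrow> complex) set" where
  "holo_disc = {f. f holomorphic_on ball 0 1 \<and> (\<forall>z. z \<notin> ball 0 1 \<longrightarrow> f z = 0)}"

definition hardy_mean :: "real \<Rightarrow> (complex \<Rightarrow> complex) \<Rightarrow> real \<Rightarrow> real" where
  "hardy_mean p f r =
     (1 / (2 * pi) * integral {0..2 * pi} (\<lambda>\<theta>. cmod (f (of_real r * exp (\<i> * of_real \<theta>))) powr p))
       powr (1 / p)"

definition hardy_space :: "real \<Rightarrow> (complex \<Rightarrow> complex) set" where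
  "hardy_space p = {f \<in> holo_disc. bdd_above (hardy_mean p f ` {0..<1})}"

definition hardy_norm :: "real \<Rightarrow> (complex \<Rightarrow> complex) \<Rightarrow> real" where
  "hardy_norm p f = (SUP r\<in>{0..<1}. hardy_mean p f r)"

definition gen_cesaro :: "real \<Rightarrow> (complex \<Rightarrow> complex) \<Rightarrow> complex \<Rightarrow> complex" where
  "gen_cesaro t f z =
     (if z = 0 then f 0
      else if z \<in> ball 0 1
      then 1 / z * contour_integral (linepath 0 z) (\<lambda>\<xi>. f \<xi> / (1 - of_real t * \<xi>))
      else 0)"

definition forward_shift :: "(complex \<Rightarrow> complex) \<Rightarrow> complex \<Rightarrow> complex" where
  "forward_shift f z = z * f z"

definition shift_cesaro :: "real \<Rightarrow> (complex \<Rightarrow> complex) \<Rightarrow> complex \<Rightarrow> complex" where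
  "shift_cesaro t = forward_shift \<circ> gen_cesaro t"

lemma shift_cesaro_eq_integral:
  assumes "z \<in> ball 0 1"
  shows "shift_cesaro t f z = contour_integral (linepath 0 z) (\<lambda>\<xi>. f \<xi> / (1 - of_real t * \<xi>))"
  using assms by (simp add: shift_cesaro_def forward_shift_def gen_cesaro_def)

text \<open>In what follows \<open>X\<close> is a complex vector space of functions with pointwise operations and
  \<open>N\<close> is a norm on \<open>X\<close>. Operators are total functions, of which only the values on \<open>X\<close> matter.\<close>

definition bounded_linear_op ::
  "(complex \<Rightarrow> complex) set \<Rightarrow> ((complex \<Rightarrow> complex) \<Rightarrow> real) \<Rightarrow>
   ((complex \<Rightarrow> complex) \<Rightarrow> complex \<Rightarrow> complex) \<Rightarrow> bool" where
  "bounded_linear_op X N T \<longleftrightarrow>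
     (\<forall>f\<in>X. T f \<in> X) \<and>
     (\<forall>f\<in>X. \<forall>g\<in>X. T (\<lambda>z. f z + g z) = (\<lambda>z. T f z + T g z)) \<and>
     (\<forall>c. \<forall>f\<in>X. T (\<lambda>z. c * f z) = (\<lambda>z. c * T f z)) \<and>
     (\<exists>K. \<forall>f\<in>X. N (T f) \<le> K * N f)"

text \<open>The supremum below is only meaningful when it is finite, so the notions built on it are
  meant for operators satisfying \<open>bounded_linear_op X N\<close>.\<close>

definition op_norm ::
  "(complex \<Rightarrow> complex) set \<Rightarrow> ((complex \<Rightarrow> complex) \<Rightarrow> real) \<Rightarrow>
   ((complex \<Rightarrow> complex) \<Rightarrow> complex \<Rightarrow> complex) \<Rightarrow> real" where
  "op_norm X N T = (SUP f\<in>{f \<in> X. N f \<le> 1}. N (T f))"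

definition power_bounded ::
  "(complex \<Rightarrow> complex) set \<Rightarrow> ((complex \<Rightarrow> complex) \<Rightarrow> real) \<Rightarrow>
   ((complex \<Rightarrow> complex) \<Rightarrow> complex \<Rightarrow> complex) \<Rightarrow> bool" where
  "power_bounded X N T \<longleftrightarrow> bdd_above (range (\<lambda>n::nat. op_norm X N (T ^^ n)))"

definition cesaro_mean ::
  "((complex \<Rightarrow> complex) \<Rightarrow> complex \<Rightarrow> complex) \<Rightarrow> nat \<Rightarrow>
   (complex \<Rightarrow> complex) \<Rightarrow> complex \<Rightarrow> complex" where
  "cesaro_mean T n f z = 1 / of_nat n * (\<Sum>m=1..n. (T ^^ m) f z)"

definition uniformly_mean_ergodic ::
  "(complex \<Rightarrow> complex) set \<Rightarrow> ((complex \<Rightarrow> complex) \<Rightarrow> real) \<Rightarrow>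
   ((complex \<Rightarrow> complex) \<Rightarrow> complex \<Rightarrow> complex) \<Rightarrow> bool" where
  "uniformly_mean_ergodic X N T \<longleftrightarrow>
     (\<exists>P. bounded_linear_op X N P \<and>
          (\<lambda>n. op_norm X N (\<lambda>f z. cesaro_mean T n f z - P f z)) \<longlonglongrightarrow> 0)"

definition projective_orbit ::
  "((complex \<Rightarrow> complex) \<Rightarrow> complex \<Rightarrow> complex) \<Rightarrow> (complex \<Rightarrow> complex) \<Rightarrow>
   (complex \<Rightarrow> complex) set" where
  "projective_orbit T x = {(\<lambda>z. c * (T ^^ n) x z) | (c::complex) (n::nat). True}"

definition supercyclic ::
  "(complex \<Rightarrow> complex) set \<Rightarrow> ((complex \<Rightarrow> complex) \<Rightarrow> real) \<Rightarrow>
   ((complex \<Rightarrow> complex) \<Rightarrow> complex \<Rightarrow> complex) \<Rightarrow> bool" where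
  "supercyclic X N T \<longleftrightarrow>
     (\<exists>x\<in>X. \<forall>y\<in>X. \<forall>e>0. \<exists>g\<in>projective_orbit T x. N (\<lambda>z. y z - g z) < e)"

end

theory Submission
  imports Defs
begin

text \<open>
  Write \<open>K = 1 / (1 - t)\<close>. Substituting \<open>\<xi> = s * z\<close> turns the generalized Cesaro operator into an average
  over the radius, \<open>C\<^sub>t f (z) = \<integral>\<^sub>0\<^sup>1 f(s z) / (1 - t s z) ds\<close>. The proof rests on what this average does to
  functions that vanish at the origin: \<open>C\<^sub>t (z\<^sup>k g) = z\<^sup>k W\<^sub>k g\<close>, where \<open>W\<^sub>k\<close> is the same average with the
  additional weight \<open>s\<^sup>k\<close>. By Jensen's inequality and an exchange of integrals, \<open>W\<^sub>k\<close> has norm at most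
  \<open>K / (k + 1)\<close> on the Hardy space (\<open>weighted_mean_hardy\<close>).

  For \<open>S\<^sub>t = z C\<^sub>t\<close> every application raises the order of the zero by one, so \<open>S\<^sub>t\<^sup>n\<close> has norm at most
  \<open>K\<^sup>n / n!\<close>. Hence the powers and the Cesaro means tend to 0.

  The functions \<open>e\<^sub>k = z\<^sup>k / (1 - t z)\<^sup>k\<^sup>+\<^sup>1\<close> satisfy \<open>C\<^sub>t e\<^sub>k = e\<^sub>k / (k + 1)\<close>. On functions with a zero of
  sufficiently high order, \<open>C\<^sub>t\<close> contracts by the factor \<open>1 / 2\<close> because of the bound for \<open>W\<^sub>k\<close>. Splitting off
  one eigenfunction at a time extends the decay rate \<open>2\<^sup>-\<^sup>n\<close> downwards to all functions with \<open>f(0) = 0\<close>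
  (\<open>cesaro_decay_step\<close>, \<open>cesaro_decay_order_1\<close>), since all eigenvalues involved are at most \<open>1 / 2\<close>. The
  remaining eigenfunction \<open>e\<^sub>0\<close> is fixed, so \<open>C\<^sub>t\<^sup>n\<close> converges in norm, at a geometric rate, to the projection
  \<open>f \<mapsto> f(0) e\<^sub>0\<close>. This gives power boundedness and uniform mean ergodicity at once
  (\<open>geometric_convergence_imp_ergodic\<close>).

  Supercyclicity fails already for the pair \<open>(f(0), f'(0))\<close>, which depends continuously on \<open>f\<close>. Along an
  orbit of \<open>C\<^sub>t\<close> the value is constant and the derivative bounded; along an orbit of \<open>S\<^sub>t\<close> the value is 0
  after one step. In both cases the pairs occurring in the projective orbit of a single function are not
  dense (\<open>not_supercyclic_if_jet_bounded\<close>).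
\<close>

section \<open>Convexity of powers\<close>

text \<open>The graph of \<open>x \<mapsto> x powr p\<close> lies above its tangent at \<open>y\<close>. The inequality is written without
  division so that it also holds at \<open>y = 0\<close>; it is Young's inequality with exponents \<open>1 / p\<close> and
  \<open>1 - 1 / p\<close>. Both Jensen inequalities below come from it by averaging, with \<open>y\<close> the mean value of \<open>x\<close>.\<close>

lemma powr_tangent:
  fixes p x y :: real
  assumes "1 \<le> p" "0 \<le> x" "0 \<le> y"
  shows "p * y powr (p - 1) * x \<le> x powr p + (p - 1) * y powr p"
proof (cases "x = 0 \<or> y = 0")
  case True
  then show ?thesis using assms by auto
next
  case False
  then have pos: "x > 0" "y > 0" using assms by auto
  have "(x powr p) powr (1 / p) * (y powr p) powr (1 - 1 / p)
      \<le> (1 / p) * (x powr p) + (1 - 1 / p) * (y powr p)"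
    by (rule Youngs_inequality_0) (use assms pos in auto)
  moreover have "(x powr p) powr (1 / p) = x" "(y powr p) powr (1 - 1 / p) = y powr (p - 1)"
    using assms pos by (auto simp: powr_powr right_diff_distrib)
  ultimately have "p * (x * y powr (p - 1)) \<le> p * ((1 / p) * (x powr p) + (1 - 1 / p) * (y powr p))"
    using assms by (intro mult_left_mono) auto
  also have "\<dots> = x powr p + (p - 1) * y powr p"
    using assms by (simp add: field_simps)
  finally show ?thesis by (simp add: mult_ac)
qed

lemma powr_minus_one_mult: "0 \<le> y \<Longrightarrow> y powr (p - 1) * y = y powr p" for p y :: real
  by (cases "y = 0") (auto simp: powr_diff)

lemma powr_convex_comb:
  fixes p a b u v :: real
  assumes "1 \<le> p" "0 \<le> a" "0 \<le> b" "a + b = 1" "0 \<le> u" "0 \<le> v"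
  shows "(a * u + b * v) powr p \<le> a * u powr p + b * v powr p"
proof -
  define y where "y = a * u + b * v"
  have y: "0 \<le> y" using assms by (simp add: y_def)
  have "a * (p * y powr (p - 1) * u) + b * (p * y powr (p - 1) * v)
      \<le> a * (u powr p + (p - 1) * y powr p) + b * (v powr p + (p - 1) * y powr p)"
    using assms y by (intro add_mono mult_left_mono powr_tangent) auto
  also have "\<dots> = a * u powr p + b * v powr p + (a + b) * ((p - 1) * y powr p)"
    by (simp add: algebra_simps)
  also have "a * (p * y powr (p - 1) * u) + b * (p * y powr (p - 1) * v) = p * (y powr (p - 1) * y)"
    by (simp add: y_def algebra_simps)
  finally have "p * y powr p \<le> a * u powr p + b * v powr p + (p - 1) * y powr p"
    using y by (simp add: powr_minus_one_mult assms)
  then show ?thesis by (simp add: y_def algebra_simps)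
qed

text \<open>Jensen's inequality for the probability density \<open>w\<close>: integrate the tangent inequality at the
  mean \<open>y\<close> of \<open>x\<close> against \<open>w\<close>.\<close>

lemma powr_integral_le:
  fixes w x :: "real \<Rightarrow> real"
  assumes p: "1 \<le> p"
    and w: "continuous_on {a..b} w" "\<And>s. s \<in> {a..b} \<Longrightarrow> 0 \<le> w s" "integral {a..b} w = 1"
    and x: "continuous_on {a..b} x" "\<And>s. s \<in> {a..b} \<Longrightarrow> 0 \<le> x s"
  shows "integral {a..b} (\<lambda>s. w s * x s) powr p \<le> integral {a..b} (\<lambda>s. w s * x s powr p)"
proof -
  define y where "y = integral {a..b} (\<lambda>s. w s * x s)"
  have cont: "continuous_on {a..b} (\<lambda>s. w s * x s)" "continuous_on {a..b} (\<lambda>s. w s * x s powr p)"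
    using w x p by (auto intro!: continuous_intros continuous_on_powr')
  have i1: "(\<lambda>s. w s * x s) integrable_on {a..b}" "(\<lambda>s. w s * x s powr p) integrable_on {a..b}"
    "w integrable_on {a..b}"
    using cont w(1) by (auto intro: integrable_continuous_real)
  have y: "0 \<le> y" unfolding y_def using i1 w x by (intro integral_nonneg) auto
  have "integral {a..b} (\<lambda>s. p * y powr (p - 1) * (w s * x s))
      \<le> integral {a..b} (\<lambda>s. w s * x s powr p + (p - 1) * y powr p * w s)"
  proof (rule integral_le)
    fix s assume s: "s \<in> {a..b}"
    have "w s * (p * y powr (p - 1) * x s) \<le> w s * (x s powr p + (p - 1) * y powr p)"
      using s w x y p by (intro mult_left_mono powr_tangent) auto
    then show "p * y powr (p - 1) * (w s * x s) \<le> w s * x s powr p + (p - 1) * y powr p * w s"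
      by (simp add: algebra_simps)
  qed (use i1 in \<open>auto intro!: integrable_on_mult_right integrable_add\<close>)
  also have "\<dots> = integral {a..b} (\<lambda>s. w s * x s powr p) + (p - 1) * y powr p"
    using i1 w(3) by (subst integral_add) (auto intro!: integrable_on_mult_right)
  also have "integral {a..b} (\<lambda>s. p * y powr (p - 1) * (w s * x s)) = p * (y powr (p - 1) * y)"
    by (simp add: y_def)
  finally show ?thesis
    using y by (simp add: powr_minus_one_mult flip: y_def) (simp add: algebra_simps)
qed

section \<open>Integral means on circles\<close>

text \<open>The Hardy mean without its normalization and outer root, so that pointwise inequalities can be
  integrated directly; \<open>hardy_mean_le_iff\<close> translates back.\<close>

definition mean_integral :: "real \<Rightarrow> (complex \<Rightarrow> complex) \<Rightarrow> real \<Rightarrow> real" where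
  "mean_integral p f r =
     integral {0..2 * pi} (\<lambda>\<theta>. cmod (f (of_real r * exp (\<i> * of_real \<theta>))) powr p)"

lemma holo_disc_continuous: "f \<in> holo_disc \<Longrightarrow> continuous_on (ball 0 1) f"
  by (auto simp: holo_disc_def intro: holomorphic_on_imp_continuous_on)

lemma continuous_on_circle:
  assumes "f \<in> holo_disc" "0 \<le> r" "r < 1"
  shows "continuous_on A (\<lambda>\<theta>. f (of_real r * exp (\<i> * of_real \<theta>)))"
  by (rule continuous_on_compose2[OF holo_disc_continuous[OF assms(1)]])
    (use assms in \<open>auto intro!: continuous_intros simp: norm_mult\<close>)

lemma mean_integrable:
  assumes "f \<in> holo_disc" "0 \<le> r" "r < 1" "1 \<le> p"
  shows "(\<lambda>\<theta>. cmod (f (of_real r * exp (\<i> * of_real \<theta>))) powr p) integrable_on {0..2 * pi}"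
  using assms by (intro integrable_continuous_real continuous_on_powr' continuous_intros continuous_on_circle) auto

lemma mean_integral_nonneg: "0 \<le> mean_integral p f r"
  unfolding mean_integral_def
  by (metis integral_nonneg not_integrable_integral order_refl powr_ge_zero)

lemma hardy_mean_nonneg: "0 \<le> hardy_mean p f r"
  by (simp add: hardy_mean_def)

lemma mean_integral_eq:
  assumes "1 \<le> p" shows "mean_integral p f r = 2 * pi * hardy_mean p f r powr p"
  using assms mean_integral_nonneg[of p f r]
  by (simp add: hardy_mean_def mean_integral_def powr_powr)

lemma hardy_mean_le_iff:
  assumes "1 \<le> p" "0 \<le> B"
  shows "hardy_mean p f r \<le> B \<longleftrightarrow> mean_integral p f r \<le> 2 * pi * B powr p"
proof -
  have "hardy_mean p f r \<le> B \<longleftrightarrow> hardy_mean p f r powr p \<le> B powr p"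
    using assms hardy_mean_nonneg[of p f r] powr_mono2[of p "hardy_mean p f r" B]
      powr_less_mono2[of p B "hardy_mean p f r"] by linarith
  then show ?thesis using assms by (simp add: mean_integral_eq)
qed

lemma hardy_mean_le_cmult:
  assumes p: "1 \<le> p" and f: "f \<in> holo_disc" and g: "g \<in> holo_disc" and r: "0 \<le> r" "r < 1" and C: "0 \<le> C"
    and le: "\<And>z. cmod z = r \<Longrightarrow> cmod (f z) \<le> C * cmod (g z)"
  shows "hardy_mean p f r \<le> C * hardy_mean p g r"
proof -
  have "mean_integral p f r \<le> C powr p * mean_integral p g r"
    unfolding mean_integral_def integral_mult_right[symmetric]
  proof (rule integral_le)
    fix \<theta> :: real
    show "cmod (f (of_real r * exp (\<i> * of_real \<theta>))) powr p
        \<le> C powr p * cmod (g (of_real r * exp (\<i> * of_real \<theta>))) powr p"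
      using p C r by (subst powr_mult[symmetric]) (auto intro!: powr_mono2 le simp: norm_mult)
  qed (use mean_integrable[OF f r p] mean_integrable[OF g r p] in \<open>auto intro: integrable_on_mult_right\<close>)
  also have "\<dots> = 2 * pi * (C * hardy_mean p g r) powr p"
    using C hardy_mean_nonneg[of p g r] by (simp add: mean_integral_eq[OF p] powr_mult)
  finally show ?thesis
    using C hardy_mean_nonneg[of p g r] by (subst hardy_mean_le_iff[OF p]) auto
qed

lemma hardy_mean_le_const:
  assumes p: "1 \<le> p" and f: "f \<in> holo_disc" and r: "0 \<le> r" "r < 1" and C: "0 \<le> C"
    and le: "\<And>z. cmod z = r \<Longrightarrow> cmod (f z) \<le> C"
  shows "hardy_mean p f r \<le> C"
proof -
  have "mean_integral p f r \<le> integral {0..2 * pi} (\<lambda>\<theta>. C powr p)"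
    unfolding mean_integral_def
  proof (rule integral_le)
    fix \<theta> :: real
    show "cmod (f (of_real r * exp (\<i> * of_real \<theta>))) powr p \<le> C powr p"
      using p C r by (auto intro!: powr_mono2 le simp: norm_mult)
  qed (use mean_integrable[OF f r p] in auto)
  then show ?thesis
    using C by (subst hardy_mean_le_iff[OF p]) auto
qed

lemma hardy_mean_cmult:
  assumes p: "1 \<le> p"
  shows "hardy_mean p (\<lambda>z. c * f z) r = cmod c * hardy_mean p f r"
proof -
  have "mean_integral p (\<lambda>z. c * f z) r = cmod c powr p * mean_integral p f r"
    unfolding mean_integral_def by (simp add: norm_mult powr_mult)
  then have "hardy_mean p (\<lambda>z. c * f z) r powr p = (cmod c * hardy_mean p f r) powr p"
    using hardy_mean_nonneg[of p f r] by (simp add: mean_integral_eq[OF p] powr_mult)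
  then show ?thesis
    using p hardy_mean_nonneg[of p f r] hardy_mean_nonneg[of p "\<lambda>z. c * f z" r]
    by (metis powr_less_mono2 less_irrefl linorder_neqE_linordered_idom less_le_trans mult_nonneg_nonneg norm_ge_zero zero_less_one)
qed

lemma holo_disc_add: "f \<in> holo_disc \<Longrightarrow> g \<in> holo_disc \<Longrightarrow> (\<lambda>z. f z + g z) \<in> holo_disc"
  and holo_disc_cmult: "f \<in> holo_disc \<Longrightarrow> (\<lambda>z. c * f z) \<in> holo_disc"
  by (auto simp: holo_disc_def intro!: holomorphic_intros)

text \<open>Minkowski's inequality. With \<open>A\<close> and \<open>B\<close> the two means, each enlarged by \<open>e / 2\<close> to keep the
  denominators positive, \<open>\<bar>f + g\<bar> / (A + B)\<close> is at most a convex combination of \<open>\<bar>f\<bar> / A\<close> and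
  \<open>\<bar>g\<bar> / B\<close>, each of which has mean at most 1.\<close>

lemma hardy_mean_triangle:
  assumes p: "1 \<le> p" and f: "f \<in> holo_disc" and g: "g \<in> holo_disc" and r: "0 \<le> r" "r < 1"
  shows "hardy_mean p (\<lambda>z. f z + g z) r \<le> hardy_mean p f r + hardy_mean p g r"
proof (rule field_le_epsilon)
  fix e :: real assume e: "0 < e"
  define A where "A = hardy_mean p f r + e / 2"
  define B where "B = hardy_mean p g r + e / 2"
  have AB: "A > 0" "B > 0"
    using e hardy_mean_nonneg[of p f r] hardy_mean_nonneg[of p g r] by (auto simp: A_def B_def)
  define a where "a = A / (A + B)"
  define b where "b = B / (A + B)"
  have ab: "0 \<le> a" "0 \<le> b" "a + b = 1"
    using AB by (auto simp: a_def b_def add_divide_distrib[symmetric])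
  define u where "u \<theta> = of_real r * exp (\<i> * of_real \<theta>)" for \<theta> :: real
  have If: "(\<lambda>\<theta>. cmod (f (u \<theta>)) powr p) integrable_on {0..2 * pi}"
    and Ig: "(\<lambda>\<theta>. cmod (g (u \<theta>)) powr p) integrable_on {0..2 * pi}"
    and Is: "(\<lambda>\<theta>. cmod (f (u \<theta>) + g (u \<theta>)) powr p) integrable_on {0..2 * pi}"
    using mean_integrable[OF f r p] mean_integrable[OF g r p] mean_integrable[OF holo_disc_add[OF f g] r p]
    by (auto simp: u_def)
  have "mean_integral p (\<lambda>z. f z + g z) r
      \<le> integral {0..2 * pi} (\<lambda>\<theta>. ((A + B) powr p * a / A powr p) * cmod (f (u \<theta>)) powr p
          + ((A + B) powr p * b / B powr p) * cmod (g (u \<theta>)) powr p)"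
    unfolding mean_integral_def
  proof (fold u_def, rule integral_le[OF Is])
    fix \<theta> :: real
    have "cmod (f (u \<theta>) + g (u \<theta>)) powr p \<le> (cmod (f (u \<theta>)) + cmod (g (u \<theta>))) powr p"
      using p by (intro powr_mono2 norm_triangle_ineq) auto
    also have "cmod (f (u \<theta>)) + cmod (g (u \<theta>))
        = (A + B) * (a * (cmod (f (u \<theta>)) / A) + b * (cmod (g (u \<theta>)) / B))"
      using AB by (simp add: a_def b_def distrib_left add_pos_pos less_imp_neq[THEN not_sym])
    also have "\<dots> powr p = (A + B) powr p * (a * (cmod (f (u \<theta>)) / A) + b * (cmod (g (u \<theta>)) / B)) powr p"
      using AB ab by (subst powr_mult) auto
    also have "\<dots> \<le> (A + B) powr p * (a * (cmod (f (u \<theta>)) / A) powr p + b * (cmod (g (u \<theta>)) / B) powr p)"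
      using p ab AB by (intro mult_left_mono powr_convex_comb) auto
    also have "\<dots> = ((A + B) powr p * a / A powr p) * cmod (f (u \<theta>)) powr p
          + ((A + B) powr p * b / B powr p) * cmod (g (u \<theta>)) powr p"
      using AB by (simp add: powr_divide distrib_left)
    finally show "cmod (f (u \<theta>) + g (u \<theta>)) powr p \<le>
        ((A + B) powr p * a / A powr p) * cmod (f (u \<theta>)) powr p
          + ((A + B) powr p * b / B powr p) * cmod (g (u \<theta>)) powr p" .
  qed (intro integrable_add integrable_on_mult_right If Ig)
  also have "\<dots> = ((A + B) powr p * a / A powr p) * mean_integral p f r
          + ((A + B) powr p * b / B powr p) * mean_integral p g r"
    unfolding mean_integral_def using If Ig
    by (fold u_def, subst integral_add) (auto intro!: integrable_on_mult_right[where c = "_ / _"] simp del: times_divide_eq_left)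
  also have "\<dots> \<le> ((A + B) powr p * a / A powr p) * (2 * pi * A powr p)
          + ((A + B) powr p * b / B powr p) * (2 * pi * B powr p)"
    using AB ab e
    by (intro add_mono mult_left_mono hardy_mean_le_iff[OF p, THEN iffD1]) (auto simp: A_def B_def)
  also have "\<dots> = 2 * pi * (A + B) powr p * (a + b)"
    using AB by (simp add: distrib_left)
  finally have "hardy_mean p (\<lambda>z. f z + g z) r \<le> A + B"
    using AB ab by (subst hardy_mean_le_iff[OF p]) auto
  then show "hardy_mean p (\<lambda>z. f z + g z) r \<le> hardy_mean p f r + hardy_mean p g r + e"
    by (simp add: A_def B_def)
qed

section \<open>The Hardy space as a normed space\<close>

lemma hardy_space_holo: "f \<in> hardy_space p \<Longrightarrow> f \<in> holo_disc"
  by (simp add: hardy_space_def)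

lemma hardy_spaceI:
  assumes "f \<in> holo_disc" "\<And>r. 0 \<le> r \<Longrightarrow> r < 1 \<Longrightarrow> hardy_mean p f r \<le> B"
  shows "f \<in> hardy_space p" "hardy_norm p f \<le> B"
  using assms unfolding hardy_space_def hardy_norm_def
  by (auto intro!: bdd_aboveI2[where M = B] cSUP_least)

lemma hardy_mean_le_norm:
  "f \<in> hardy_space p \<Longrightarrow> 0 \<le> r \<Longrightarrow> r < 1 \<Longrightarrow> hardy_mean p f r \<le> hardy_norm p f"
  unfolding hardy_space_def hardy_norm_def by (intro cSUP_upper) auto

lemma hardy_norm_nonneg: "f \<in> hardy_space p \<Longrightarrow> 0 \<le> hardy_norm p f"
  using hardy_mean_le_norm[of f p 0] hardy_mean_nonneg[of p f 0] by auto

lemma hardy_space_add: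
  assumes p: "1 \<le> p" and f: "f \<in> hardy_space p" and g: "g \<in> hardy_space p"
  shows "(\<lambda>z. f z + g z) \<in> hardy_space p"
    and "hardy_norm p (\<lambda>z. f z + g z) \<le> hardy_norm p f + hardy_norm p g"
proof -
  have "hardy_mean p (\<lambda>z. f z + g z) r \<le> hardy_norm p f + hardy_norm p g" if "0 \<le> r" "r < 1" for r
    using hardy_mean_triangle[OF p hardy_space_holo[OF f] hardy_space_holo[OF g] that]
      hardy_mean_le_norm[OF f that] hardy_mean_le_norm[OF g that] by linarith
  from hardy_spaceI[OF _ this] show "(\<lambda>z. f z + g z) \<in> hardy_space p"
    and "hardy_norm p (\<lambda>z. f z + g z) \<le> hardy_norm p f + hardy_norm p g"
    using f g by (auto intro: holo_disc_add hardy_space_holo)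
qed

lemma hardy_space_cmult:
  assumes p: "1 \<le> p" and f: "f \<in> hardy_space p"
  shows "(\<lambda>z. c * f z) \<in> hardy_space p"
    and "hardy_norm p (\<lambda>z. c * f z) \<le> cmod c * hardy_norm p f"
proof -
  have "hardy_mean p (\<lambda>z. c * f z) r \<le> cmod c * hardy_norm p f" if "0 \<le> r" "r < 1" for r
    using hardy_mean_le_norm[OF f that] by (simp add: hardy_mean_cmult[OF p] mult_left_mono)
  from hardy_spaceI[OF _ this] show "(\<lambda>z. c * f z) \<in> hardy_space p"
    and "hardy_norm p (\<lambda>z. c * f z) \<le> cmod c * hardy_norm p f"
    using f by (auto intro: holo_disc_cmult hardy_space_holo)
qed

lemma hardy_space_diff:
  assumes p: "1 \<le> p" and f: "f \<in> hardy_space p" and g: "g \<in> hardy_space p"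
  shows "(\<lambda>z. f z - g z) \<in> hardy_space p"
    and "hardy_norm p (\<lambda>z. f z - g z) \<le> hardy_norm p f + hardy_norm p g"
  using hardy_space_add[OF p f hardy_space_cmult(1)[OF p g, of "-1"]]
    hardy_space_cmult(2)[OF p g, of "-1"] by auto

lemma hardy_space_zero:
  assumes "1 \<le> p" shows "(\<lambda>z. 0) \<in> hardy_space p" "hardy_norm p (\<lambda>z. 0) = 0"
proof -
  have *: "hardy_mean p (\<lambda>z. 0) r \<le> 0" if "0 \<le> r" "r < 1" for r
    using hardy_mean_cmult[OF assms, of 0 "\<lambda>z. 0" r] by simp
  have "(\<lambda>z. 0) \<in> holo_disc" by (auto simp: holo_disc_def)
  from hardy_spaceI[OF this *] hardy_norm_nonneg[of "\<lambda>z. 0" p]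
  show "(\<lambda>z. 0) \<in> hardy_space p" "hardy_norm p (\<lambda>z. 0) = 0" by auto
qed

lemma hardy_space_sum:
  assumes p: "1 \<le> p" and "finite I" and f: "\<And>i. i \<in> I \<Longrightarrow> f i \<in> hardy_space p"
  shows "(\<lambda>z. \<Sum>i\<in>I. f i z) \<in> hardy_space p \<and>
    hardy_norm p (\<lambda>z. \<Sum>i\<in>I. f i z) \<le> (\<Sum>i\<in>I. hardy_norm p (f i))"
  using assms(2) f
proof (induction rule: finite_induct)
  case empty
  then show ?case by (simp add: hardy_space_zero[OF p])
next
  case (insert i I)
  then show ?case
    using hardy_space_add[OF p, of "f i" "\<lambda>z. \<Sum>i\<in>I. f i z"] by force
qed

section \<open>Evaluation near the origin\<close>

text \<open>Cauchy's formula on the circle of radius \<open>3 / 4\<close>, whose points have distance at least \<open>1 / 4\<close> from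
  \<open>z\<close>: the kernel is bounded by \<open>(3 / 4) / (1 / 4) = 3\<close>, and Jensen's inequality compares the resulting
  \<open>L\<^sup>1\<close> mean with the \<open>L\<^sup>p\<close> mean.\<close>

lemma cmod_le_hardy_mean:
  assumes p: "1 \<le> p" and f: "f \<in> holo_disc" and z: "cmod z \<le> 1 / 2"
  shows "cmod (f z) \<le> 3 * hardy_mean p f (3 / 4)"
proof -
  define u where "u \<theta> = of_real (3 / 4) * exp (\<i> * of_real \<theta>)" for \<theta> :: real
  have u: "cmod (u \<theta>) = 3 / 4" for \<theta> by (simp add: u_def norm_mult)
  have u_cis: "u \<theta> = of_real (3 / 4) * cis \<theta>" for \<theta> by (simp add: u_def cis_conv_exp)
  have contu: "continuous_on {0..2 * pi} (\<lambda>\<theta>. f (u \<theta>))"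
    unfolding u_def by (intro continuous_on_circle f) auto
  have J: "integral {0..2 * pi} (\<lambda>\<theta>. 1 / (2 * pi) * cmod (f (u \<theta>))) \<le> hardy_mean p f (3 / 4)"
  proof -
    let ?I = "integral {0..2 * pi} (\<lambda>\<theta>. 1 / (2 * pi) * cmod (f (u \<theta>)))"
    have nn: "0 \<le> ?I"
      using contu by (intro integral_nonneg integrable_continuous_real continuous_intros) auto
    have "?I powr p \<le> integral {0..2 * pi} (\<lambda>\<theta>. 1 / (2 * pi) * cmod (f (u \<theta>)) powr p)"
      by (rule powr_integral_le[OF p]) (use contu in \<open>auto intro!: continuous_intros\<close>)
    also have "\<dots> = hardy_mean p f (3 / 4) powr p"
      using mean_integral_eq[OF p, of f "3 / 4"] unfolding mean_integral_def by (simp add: u_def)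
    finally show ?thesis
      using p powr_less_mono2[of p "hardy_mean p f (3 / 4)" ?I] hardy_mean_nonneg[of p f "3 / 4"]
      by linarith
  qed
  have "((\<lambda>w. f w / (w - z)) has_contour_integral (2 * of_real pi * \<i> * f z)) (circlepath 0 (3 / 4))"
    using f z by (intro Cauchy_integral_circlepath_simple) (auto simp: holo_disc_def elim!: holomorphic_on_subset)
  then have *: "((\<lambda>\<theta>. f (u \<theta>) / (u \<theta> - z) * of_real (3 / 4) * \<i> * cis \<theta>) has_integral
      (2 * of_real pi * \<i> * f z)) {0..2 * pi}"
    unfolding circlepath_def by (subst (asm) has_contour_integral_part_circlepath_iff) (auto simp: u_cis)
  have "cmod (2 * of_real pi * \<i> * f z) = cmod (integral {0..2 * pi} (\<lambda>\<theta>. f (u \<theta>) / (u \<theta> - z) * of_real (3 / 4) * \<i> * cis \<theta>))"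
    using * by (simp add: integral_unique)
  also have "\<dots> \<le> integral {0..2 * pi} (\<lambda>\<theta>. 6 * pi * (1 / (2 * pi) * cmod (f (u \<theta>))))"
  proof (rule integral_norm_bound_integral)
    fix \<theta> :: real
    have "1 / 4 \<le> cmod (u \<theta> - z)"
      using norm_triangle_ineq2[of "u \<theta>" z] z u[of \<theta>] by linarith
    then have "cmod (f (u \<theta>)) * (3 / 4) / cmod (u \<theta> - z) \<le> cmod (f (u \<theta>)) * (3 / 4) / (1 / 4)"
      by (intro divide_left_mono) auto
    then show "cmod (f (u \<theta>) / (u \<theta> - z) * of_real (3 / 4) * \<i> * cis \<theta>) \<le> 6 * pi * (1 / (2 * pi) * cmod (f (u \<theta>)))"
      unfolding norm_mult norm_divide by simp
  next
    show "(\<lambda>\<theta>. f (u \<theta>) / (u \<theta> - z) * of_real (3 / 4) * \<i> * cis \<theta>) integrable_on {0..2 * pi}"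
      using * by (rule has_integral_integrable)
    show "(\<lambda>\<theta>. 6 * pi * (1 / (2 * pi) * cmod (f (u \<theta>)))) integrable_on {0..2 * pi}"
      by (intro integrable_continuous_real continuous_intros contu)
  qed
  also have "\<dots> = 6 * pi * integral {0..2 * pi} (\<lambda>\<theta>. 1 / (2 * pi) * cmod (f (u \<theta>)))"
    by (rule integral_mult_right)
  also have "\<dots> \<le> 6 * pi * hardy_mean p f (3 / 4)"
    using J by (intro mult_left_mono) auto
  finally show ?thesis by (simp add: norm_mult)
qed

section \<open>Weighted radial averages\<close>

text \<open>For \<open>k = 0\<close> this is the generalized Cesaro operator, written as an average over the radius of \<open>z\<close>.
  The higher weights describe that operator on functions with a zero of order \<open>k\<close> at the origin
  (\<open>weighted_mean_power_mult\<close>), where the factor \<open>s ^ k\<close> makes it small.\<close>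

definition weighted_mean :: "nat \<Rightarrow> real \<Rightarrow> (complex \<Rightarrow> complex) \<Rightarrow> complex \<Rightarrow> complex" where
  "weighted_mean k t f z =
     (if z \<in> ball 0 1
      then integral {0..1} (\<lambda>s. of_real s ^ k * (f (of_real s * z) / (1 - of_real t * (of_real s * z))))
      else 0)"

lemma gen_cesaro_eq: "gen_cesaro t f = weighted_mean 0 t f"
proof
  fix z
  have "contour_integral (linepath 0 z) (\<lambda>\<xi>. f \<xi> / (1 - of_real t * \<xi>))
      = z * integral {0..1} (\<lambda>s. f (of_real s * z) / (1 - of_real t * (of_real s * z)))"
    unfolding contour_integral_integral integral_mult_right[symmetric]
    by (rule integral_cong) (simp add: linepath_def scaleR_conv_of_real mult_ac)
  then show "gen_cesaro t f z = weighted_mean 0 t f z"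
    by (auto simp: gen_cesaro_def weighted_mean_def)
qed

lemma shift_cesaro_eq: "shift_cesaro t f = (\<lambda>z. z * weighted_mean 0 t f z)"
  by (auto simp: shift_cesaro_def forward_shift_def gen_cesaro_eq fun_eq_iff)

lemma weighted_mean_power_mult:
  "weighted_mean j t (\<lambda>z. z ^ k * g z) = (\<lambda>z. z ^ k * weighted_mean (j + k) t g z)"
proof
  fix z
  have "integral {0..1} (\<lambda>s. of_real s ^ j * ((of_real s * z) ^ k * g (of_real s * z) / (1 - of_real t * (of_real s * z))))
     = z ^ k * integral {0..1} (\<lambda>s. of_real s ^ (j + k) * (g (of_real s * z) / (1 - of_real t * (of_real s * z))))"
    unfolding integral_mult_right[symmetric]
    by (rule integral_cong) (simp add: power_mult_distrib power_add mult_ac)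
  then show "weighted_mean j t (\<lambda>z. z ^ k * g z) z = z ^ k * weighted_mean (j + k) t g z"
    by (simp add: weighted_mean_def)
qed

lemma norm_of_real_mult_less:
  fixes z :: complex assumes "0 \<le> s" "s \<le> 1" "cmod z < 1" shows "cmod (of_real s * z) < 1"
  using assms by (simp add: norm_mult) (meson le_less_trans mult_left_le_one_le norm_ge_zero)

lemma cesaro_kernel_bound:
  assumes "0 \<le> t" "t < 1" "cmod z < 1"
  shows "1 - t \<le> cmod (1 - of_real t * z)" "1 - of_real t * z \<noteq> 0"
proof -
  have "cmod (of_real t * z) \<le> t" using assms by (simp add: norm_mult mult_left_le)
  then show "1 - t \<le> cmod (1 - of_real t * z)"
    using norm_triangle_ineq2[of 1 "of_real t * z"] by simp
  then show "1 - of_real t * z \<noteq> 0" using assms by auto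
qed

lemma continuous_on_radial:
  assumes "f \<in> holo_disc" "0 \<le> t" "t < 1" "cmod z < 1"
  shows "continuous_on {0..1} (\<lambda>s. f (of_real s * z))"
    and "continuous_on {0..1} (\<lambda>s. of_real s ^ k * (f (of_real s * z) / (1 - of_real t * (of_real s * z))))"
proof -
  show *: "continuous_on {0..1} (\<lambda>s. f (of_real s * z))"
    by (rule continuous_on_compose2[OF holo_disc_continuous[OF assms(1)]])
      (use assms norm_of_real_mult_less in \<open>auto intro!: continuous_intros\<close>)
  show "continuous_on {0..1} (\<lambda>s. of_real s ^ k * (f (of_real s * z) / (1 - of_real t * (of_real s * z))))"
    using * assms norm_of_real_mult_less cesaro_kernel_bound(2)[OF assms(2,3)]
    by (intro continuous_intros) auto
qed

lemma weighted_mean_holo_disc: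
  assumes f: "f \<in> holo_disc" and t: "0 \<le> t" "t < 1"
  shows "weighted_mean k t f \<in> holo_disc"
proof -
  define h where "h w = f w / (1 - of_real t * w)" for w
  have hol: "h holomorphic_on ball 0 1"
    unfolding h_def using f cesaro_kernel_bound(2)[OF t]
    by (auto simp: holo_disc_def intro!: holomorphic_intros)
  have der: "(h has_field_derivative deriv h w) (at w)" if "cmod w < 1" for w
    using holomorphic_derivI[OF hol] that by auto
  have contd: "continuous_on (ball 0 1) (deriv h)"
    using hol by (intro holomorphic_on_imp_continuous_on holomorphic_deriv) auto
  have "(\<lambda>z. integral (cbox 0 1) (\<lambda>s. of_real s ^ k * h (of_real s * z))) holomorphic_on ball 0 1"
  proof (rule leibniz_rule_holomorphic)
    fix z :: complex and s :: real assume zs: "z \<in> ball 0 1" "s \<in> cbox 0 1"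
    then have "cmod (of_real s * z) < 1" using norm_of_real_mult_less by auto
    then have "((\<lambda>z. h (of_real s * z)) has_field_derivative deriv h (of_real s * z) * of_real s) (at z)"
      using DERIV_chain2[OF der DERIV_cmult_Id] by blast
    then show "((\<lambda>z. of_real s ^ k * h (of_real s * z)) has_field_derivative
        of_real s ^ k * (deriv h (of_real s * z) * of_real s)) (at z within ball 0 1)"
      by (rule DERIV_cmult[OF has_field_derivative_at_within])
  next
    fix z :: complex assume "z \<in> ball 0 1"
    then show "(\<lambda>s. of_real s ^ k * h (of_real s * z)) integrable_on cbox 0 1"
      using continuous_on_radial(2)[OF f t, of z k] unfolding h_def
      by (auto intro: integrable_continuous_real)
  next
    have "continuous_on (ball 0 1 \<times> cbox 0 1) (\<lambda>x. deriv h (of_real (snd x) * fst x))"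
    proof (rule continuous_on_compose2[OF contd])
      show "continuous_on (ball 0 1 \<times> cbox 0 1) (\<lambda>x. of_real (snd x) * fst x :: complex)"
        by (intro continuous_intros)
      show "(\<lambda>x. of_real (snd x) * fst x :: complex) ` (ball 0 1 \<times> cbox 0 1) \<subseteq> ball 0 1"
        using norm_of_real_mult_less by auto
    qed
    then show "continuous_on (ball 0 1 \<times> cbox 0 1) (\<lambda>(z, s). of_real s ^ k * (deriv h (of_real s * z) * of_real s))"
      unfolding split_beta by (intro continuous_intros)
  qed auto
  then have "weighted_mean k t f holomorphic_on ball 0 1"
    by (rule holomorphic_transform) (auto simp: weighted_mean_def h_def)
  then show ?thesis by (auto simp: holo_disc_def weighted_mean_def)
qed

text \<open>Minkowski's inequality for integrals, in the one case that matters. The kernel is at most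
  \<open>1 / (1 - t)\<close>, and \<open>w s = (k + 1) * s ^ k\<close> is a probability density on \<open>[0, 1]\<close>. Jensen's inequality moves
  the power \<open>p\<close> under the integral over \<open>s\<close>, and exchanging the order of integration leaves an average of
  the means of \<open>f\<close> over the smaller circles of radius \<open>s * r\<close>. The gain \<open>1 / (k + 1)\<close> is the normalization
  of the density.\<close>

lemma hardy_mean_weighted_mean:
  assumes p: "1 \<le> p" and t: "0 \<le> t" "t < 1" and f: "f \<in> holo_disc" and B: "0 \<le> B"
    and le: "\<And>r. 0 \<le> r \<Longrightarrow> r < 1 \<Longrightarrow> hardy_mean p f r \<le> B" and r: "0 \<le> r" "r < 1"
  shows "hardy_mean p (weighted_mean k t f) r \<le> B / ((1 - t) * real (Suc k))"
proof -
  define w where "w s = real (Suc k) * s ^ k" for s :: real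
  define K where "K = 1 / ((1 - t) * real (Suc k))"
  define u where "u \<theta> = of_real r * exp (\<i> * of_real \<theta>)" for \<theta> :: real
  have u: "cmod (u \<theta>) < 1" for \<theta> using r by (simp add: u_def norm_mult)
  have K: "0 \<le> K" using t by (simp add: K_def)
  have w: "continuous_on {0..1} w" "\<And>s. s \<in> {0..1} \<Longrightarrow> 0 \<le> w s" "integral {0..1} w = 1"
  proof -
    have "(w has_integral 1 ^ Suc k - 0 ^ Suc k) {0..1}"
      unfolding w_def
      by (rule fundamental_theorem_of_calculus)
        (auto intro!: derivative_eq_intros simp flip: has_real_derivative_iff_has_vector_derivative simp del: power_Suc)
    then show "integral {0..1} w = 1" by (auto dest: integral_unique)
  qed (auto simp: w_def intro!: continuous_intros)
  define F where "F \<theta> s = w s * cmod (f (of_real s * u \<theta>)) powr p" for \<theta> s :: real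
  have "continuous_on (cbox (0, 0) (2 * pi, 1)) (\<lambda>x. f (of_real (snd x) * u (fst x)))"
  proof (rule continuous_on_compose2[OF holo_disc_continuous[OF f]])
    show "continuous_on (cbox (0, 0) (2 * pi, 1)) (\<lambda>x. of_real (snd x) * u (fst x))"
      unfolding u_def by (intro continuous_intros)
    show "(\<lambda>x. of_real (snd x) * u (fst x)) ` cbox (0, 0) (2 * pi, 1) \<subseteq> ball 0 1"
      using u norm_of_real_mult_less by (auto simp: cbox_Pair_eq)
  qed
  then have contF: "continuous_on (cbox (0, 0) (2 * pi, 1)) (\<lambda>(\<theta>, s). F \<theta> s)"
    unfolding split_beta F_def w_def using p
    by (intro continuous_intros continuous_on_powr') auto
  have contI: "continuous_on {0..2 * pi} (\<lambda>\<theta>. integral {0..1} (F \<theta>))"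
    using integral_continuous_on_param[of "{0..2 * pi}" 0 1 F] contF by (simp add: cbox_Pair_eq)
  have pointwise: "cmod (weighted_mean k t f (u \<theta>)) powr p \<le> K powr p * integral {0..1} (F \<theta>)" for \<theta>
  proof -
    note cont = continuous_on_radial[OF f t u[of \<theta>]]
    have "cmod (weighted_mean k t f (u \<theta>)) \<le> integral {0..1} (\<lambda>s. K * (w s * cmod (f (of_real s * u \<theta>))))"
      unfolding weighted_mean_def using u[of \<theta>]
    proof (simp only: mem_ball dist_0_norm if_True, intro integral_norm_bound_integral)
      fix s :: real assume s: "s \<in> {0..1}"
      have "cmod (f (of_real s * u \<theta>)) / cmod (1 - of_real t * (of_real s * u \<theta>)) \<le> cmod (f (of_real s * u \<theta>)) / (1 - t)"
        using cesaro_kernel_bound[OF t norm_of_real_mult_less[OF _ _ u]] s t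
        by (intro divide_left_mono mult_pos_pos) auto
      then have "s ^ k * (cmod (f (of_real s * u \<theta>)) / cmod (1 - of_real t * (of_real s * u \<theta>)))
          \<le> s ^ k * (cmod (f (of_real s * u \<theta>)) / (1 - t))"
        using s by (intro mult_left_mono) auto
      also have "\<dots> = K * (w s * cmod (f (of_real s * u \<theta>)))"
        unfolding K_def w_def using t by (simp add: field_simps del: of_nat_Suc)
      finally show "cmod (of_real s ^ k * (f (of_real s * u \<theta>) / (1 - of_real t * (of_real s * u \<theta>))))
          \<le> K * (w s * cmod (f (of_real s * u \<theta>)))"
        using s unfolding norm_mult norm_divide norm_power by simp
    qed (intro integrable_continuous_real continuous_intros cont w)+
    then have "cmod (weighted_mean k t f (u \<theta>)) powr p
        \<le> (K * integral {0..1} (\<lambda>s. w s * cmod (f (of_real s * u \<theta>)))) powr p"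
      using p by (intro powr_mono2) auto
    also have "\<dots> = K powr p * integral {0..1} (\<lambda>s. w s * cmod (f (of_real s * u \<theta>))) powr p"
      by (rule powr_mult)
    also have "\<dots> \<le> K powr p * integral {0..1} (F \<theta>)"
      unfolding F_def using K w cont
      by (intro mult_left_mono powr_integral_le[OF p]) (auto intro!: continuous_intros)
    finally show ?thesis .
  qed
  have "mean_integral p (weighted_mean k t f) r \<le> integral {0..2 * pi} (\<lambda>\<theta>. K powr p * integral {0..1} (F \<theta>))"
    unfolding mean_integral_def
  proof (rule integral_le)
    show "(\<lambda>\<theta>. cmod (weighted_mean k t f (of_real r * exp (\<i> * of_real \<theta>))) powr p) integrable_on {0..2 * pi}"
      by (intro mean_integrable weighted_mean_holo_disc f t r p)
    show "(\<lambda>\<theta>. K powr p * integral {0..1} (F \<theta>)) integrable_on {0..2 * pi}"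
      by (intro integrable_continuous_real continuous_intros contI)
  qed (use pointwise in \<open>auto simp: u_def\<close>)
  also have "\<dots> = K powr p * integral {0..2 * pi} (\<lambda>\<theta>. integral {0..1} (F \<theta>))"
    by simp
  also have "integral {0..2 * pi} (\<lambda>\<theta>. integral {0..1} (F \<theta>)) = integral {0..1} (\<lambda>s. integral {0..2 * pi} (\<lambda>\<theta>. F \<theta> s))"
    using integral_swap_continuous[OF contF] by simp
  also have "(\<lambda>s. integral {0..2 * pi} (\<lambda>\<theta>. F \<theta> s)) = (\<lambda>s. w s * mean_integral p f (s * r))"
    unfolding F_def mean_integral_def by (simp add: u_def mult_ac)
  also have "integral {0..1} (\<lambda>s. w s * mean_integral p f (s * r)) \<le> integral {0..1} (\<lambda>s. w s * (2 * pi * B powr p))"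
  proof (rule integral_le)
    have "continuous_on {0..1} (\<lambda>s. integral {0..2 * pi} (\<lambda>\<theta>. F \<theta> s))"
    proof -
      have "continuous_on (cbox (0, 0) (1, 2 * pi)) ((\<lambda>(\<theta>, s). F \<theta> s) \<circ> prod.swap)"
        by (intro continuous_on_compose continuous_on_swap continuous_on_subset[OF contF]) (auto simp: cbox_Pair_eq)
      then show ?thesis
        using integral_continuous_on_param[of "{0..1}" 0 "2 * pi" "\<lambda>s \<theta>. F \<theta> s"]
        by (simp add: cbox_Pair_eq prod.swap_def comp_def case_prod_unfold)
    qed
    also have "(\<lambda>s. integral {0..2 * pi} (\<lambda>\<theta>. F \<theta> s)) = (\<lambda>s. w s * mean_integral p f (s * r))"
      unfolding F_def mean_integral_def by (simp add: u_def mult_ac)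
    finally show "(\<lambda>s. w s * mean_integral p f (s * r)) integrable_on {0..1}"
      by (rule integrable_continuous_real)
    show "(\<lambda>s. w s * (2 * pi * B powr p)) integrable_on {0..1}"
      using w by (intro integrable_continuous_real continuous_intros)
  next
    fix s :: real assume s: "s \<in> {0..1}"
    then have "s * r \<le> r" using r by (simp add: mult_left_le_one_le)
    then show "w s * mean_integral p f (s * r) \<le> w s * (2 * pi * B powr p)"
      using s r w(2) by (intro mult_left_mono hardy_mean_le_iff[OF p B, THEN iffD1] le) auto
  qed
  also have "\<dots> = 2 * pi * B powr p"
    using w(3) by simp
  finally have "mean_integral p (weighted_mean k t f) r \<le> K powr p * (2 * pi * B powr p)"
    by (simp add: mult_left_mono)
  also have "\<dots> = 2 * pi * (B * K) powr p"
    using K B by (simp add: powr_mult)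
  finally have "hardy_mean p (weighted_mean k t f) r \<le> B * K"
    using K B by (subst hardy_mean_le_iff[OF p]) auto
  then show ?thesis by (simp add: K_def)
qed

lemma weighted_mean_hardy:
  assumes p: "1 \<le> p" and t: "0 \<le> t" "t < 1" and f: "f \<in> hardy_space p"
  shows "weighted_mean k t f \<in> hardy_space p"
    and "hardy_norm p (weighted_mean k t f) \<le> hardy_norm p f / ((1 - t) * real (Suc k))"
proof -
  have "hardy_mean p (weighted_mean k t f) r \<le> hardy_norm p f / ((1 - t) * real (Suc k))" if "0 \<le> r" "r < 1" for r
    by (intro hardy_mean_weighted_mean p t that hardy_space_holo[OF f] hardy_norm_nonneg[OF f] hardy_mean_le_norm[OF f])
  from hardy_spaceI[OF weighted_mean_holo_disc[OF hardy_space_holo[OF f] t] this]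
  show "weighted_mean k t f \<in> hardy_space p"
    and "hardy_norm p (weighted_mean k t f) \<le> hardy_norm p f / ((1 - t) * real (Suc k))" by auto
qed

lemma weighted_mean_add:
  assumes t: "0 \<le> t" "t < 1" and f: "f \<in> holo_disc" and g: "g \<in> holo_disc"
  shows "weighted_mean k t (\<lambda>z. f z + g z) = (\<lambda>z. weighted_mean k t f z + weighted_mean k t g z)"
proof -
  have int: "(\<lambda>s. of_real s ^ k * (h (of_real s * z) / (1 - of_real t * (of_real s * z)))) integrable_on {0..1}"
    if "h \<in> holo_disc" "cmod z < 1" for h z
    using continuous_on_radial(2)[OF that(1) t that(2), of k] by (rule integrable_continuous_real)
  show ?thesis
    unfolding weighted_mean_def fun_eq_iff add_divide_distrib distrib_left
    using integral_add[OF int[OF f] int[OF g]] by simp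
qed

lemma weighted_mean_cmult:
  "weighted_mean k t (\<lambda>z. c * f z) = (\<lambda>z. c * weighted_mean k t f z)"
proof -
  have "integral {0..1} (\<lambda>s. of_real s ^ k * (c * f (of_real s * z) / (1 - of_real t * (of_real s * z))))
     = c * integral {0..1} (\<lambda>s. of_real s ^ k * (f (of_real s * z) / (1 - of_real t * (of_real s * z))))" for z
    unfolding integral_mult_right[symmetric] by (rule integral_cong) (simp add: mult_ac)
  then show ?thesis
    by (auto simp: weighted_mean_def fun_eq_iff)
qed

section \<open>Criteria for ergodicity and against supercyclicity\<close>

lemma bounded_linear_op_funpow:
  assumes T: "bounded_linear_op X N T"
  shows "f \<in> X \<Longrightarrow> (T ^^ n) f \<in> X"
    and "f \<in> X \<Longrightarrow> g \<in> X \<Longrightarrow> (T ^^ n) (\<lambda>z. f z + g z) = (\<lambda>z. (T ^^ n) f z + (T ^^ n) g z)"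
    and "f \<in> X \<Longrightarrow> (T ^^ n) (\<lambda>z. c * f z) = (\<lambda>z. c * (T ^^ n) f z)"
proof -
  have X: "(T ^^ n) f \<in> X" if "f \<in> X" for f n
    using that T by (induction n) (auto simp: bounded_linear_op_def)
  show "f \<in> X \<Longrightarrow> (T ^^ n) f \<in> X" by (rule X)
  show "f \<in> X \<Longrightarrow> g \<in> X \<Longrightarrow> (T ^^ n) (\<lambda>z. f z + g z) = (\<lambda>z. (T ^^ n) f z + (T ^^ n) g z)"
    using T X by (induction n) (auto simp: bounded_linear_op_def)
  show "f \<in> X \<Longrightarrow> (T ^^ n) (\<lambda>z. c * f z) = (\<lambda>z. c * (T ^^ n) f z)"
    using T X by (induction n) (auto simp: bounded_linear_op_def)
qed

text \<open>The lower bound is needed because \<open>op_norm\<close> is a supremum of reals: it is informative only once the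
  values on the unit ball are known to be bounded, and then the zero function bounds it below.\<close>

lemma op_norm_bounds:
  assumes p: "1 \<le> p" and "\<And>f. f \<in> hardy_space p \<Longrightarrow> hardy_norm p f \<le> 1 \<Longrightarrow>
      T f \<in> hardy_space p \<and> hardy_norm p (T f) \<le> C"
  shows "0 \<le> op_norm (hardy_space p) (hardy_norm p) T" "op_norm (hardy_space p) (hardy_norm p) T \<le> C"
proof -
  let ?B = "{f \<in> hardy_space p. hardy_norm p f \<le> 1}"
  have z: "(\<lambda>z. 0) \<in> ?B" by (simp add: hardy_space_zero[OF p])
  then show "op_norm (hardy_space p) (hardy_norm p) T \<le> C"
    unfolding op_norm_def using assms by (intro cSUP_least) auto
  have "hardy_norm p (T (\<lambda>z. 0)) \<le> op_norm (hardy_space p) (hardy_norm p) T"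
    unfolding op_norm_def using assms z by (intro cSUP_upper bdd_aboveI2[where M = C]) auto
  then show "0 \<le> op_norm (hardy_space p) (hardy_norm p) T"
    using assms(2)[of "\<lambda>z. 0"] z hardy_norm_nonneg[of "T (\<lambda>z. 0)" p] by auto
qed

text \<open>If the powers themselves approach an operator \<open>P\<close> at a geometric rate, then they are bounded, and the
  Cesaro means differ from \<open>P\<close> by at most the total error \<open>C / (1 - q)\<close> divided by \<open>n\<close>.\<close>

lemma geometric_convergence_imp_ergodic:
  assumes p: "1 \<le> p" and T: "bounded_linear_op (hardy_space p) (hardy_norm p) T"
    and P: "bounded_linear_op (hardy_space p) (hardy_norm p) P"
    and q: "0 \<le> q" "q < 1" and C: "0 \<le> C"
    and conv: "\<And>f n. f \<in> hardy_space p \<Longrightarrow>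
      hardy_norm p (\<lambda>z. (T ^^ n) f z - P f z) \<le> C * q ^ n * hardy_norm p f"
  shows "power_bounded (hardy_space p) (hardy_norm p) T"
    and "uniformly_mean_ergodic (hardy_space p) (hardy_norm p) T"
proof -
  note T_pow = bounded_linear_op_funpow(1)[OF T]
  have P_in: "P f \<in> hardy_space p" if "f \<in> hardy_space p" for f
    using P that by (auto simp: bounded_linear_op_def)
  obtain K where K: "\<And>f. f \<in> hardy_space p \<Longrightarrow> hardy_norm p (P f) \<le> K * hardy_norm p f"
    using P unfolding bounded_linear_op_def by blast
  have unit: "hardy_norm p (\<lambda>z. (T ^^ n) f z - P f z) \<le> C * q ^ n"
    if "f \<in> hardy_space p" "hardy_norm p f \<le> 1" for f n
    using conv[OF that(1), of n] mult_left_le[OF that(2), of "C * q ^ n"] C q by simp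
  have "op_norm (hardy_space p) (hardy_norm p) (T ^^ n) \<le> C + \<bar>K\<bar>" for n
  proof (intro op_norm_bounds p conjI)
    fix f assume f: "f \<in> hardy_space p" "hardy_norm p f \<le> 1"
    have "hardy_norm p (\<lambda>z. ((T ^^ n) f z - P f z) + P f z)
        \<le> hardy_norm p (\<lambda>z. (T ^^ n) f z - P f z) + hardy_norm p (P f)"
      by (intro hardy_space_add(2) hardy_space_diff(1) p T_pow P_in f)
    also have "\<dots> \<le> C * q ^ n + K * hardy_norm p f"
      by (intro add_mono unit f K)
    also have "\<dots> \<le> C + \<bar>K\<bar>"
    proof (rule add_mono)
      show "C * q ^ n \<le> C" using C q by (simp add: mult_left_le power_le_one)
      have "K * hardy_norm p f \<le> \<bar>K\<bar> * hardy_norm p f"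
        using hardy_norm_nonneg[OF f(1)] by (intro mult_right_mono) auto
      also have "\<dots> \<le> \<bar>K\<bar>" using f(2) by (intro mult_left_le) auto
      finally show "K * hardy_norm p f \<le> \<bar>K\<bar>" .
    qed
    finally show "hardy_norm p ((T ^^ n) f) \<le> C + \<bar>K\<bar>" by simp
  qed (rule T_pow)
  then show "power_bounded (hardy_space p) (hardy_norm p) T"
    unfolding power_bounded_def by (intro bdd_aboveI2)

  define D where "D n = op_norm (hardy_space p) (hardy_norm p) (\<lambda>f z. cesaro_mean T n f z - P f z)" for n
  have D: "0 \<le> D n" "D n \<le> (C / (1 - q)) / real n" if n: "n \<ge> 1" for n
  proof -
    have "(\<lambda>z. cesaro_mean T n f z - P f z) \<in> hardy_space p \<and>
        hardy_norm p (\<lambda>z. cesaro_mean T n f z - P f z) \<le> (C / (1 - q)) / real n"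
      if f: "f \<in> hardy_space p" "hardy_norm p f \<le> 1" for f
    proof -
      have eq: "(\<lambda>z. cesaro_mean T n f z - P f z)
          = (\<lambda>z. (1 / of_nat n) * (\<Sum>m=1..n. (T ^^ m) f z - P f z))"
        using n by (simp add: cesaro_mean_def sum_subtractf fun_eq_iff field_simps)
      have S: "(\<lambda>z. \<Sum>m=1..n. (T ^^ m) f z - P f z) \<in> hardy_space p \<and>
          hardy_norm p (\<lambda>z. \<Sum>m=1..n. (T ^^ m) f z - P f z)
            \<le> (\<Sum>m=1..n. hardy_norm p (\<lambda>z. (T ^^ m) f z - P f z))"
        by (intro hardy_space_sum p finite_atLeastAtMost hardy_space_diff(1) T_pow P_in f)
      have "(\<Sum>m=1..n. hardy_norm p (\<lambda>z. (T ^^ m) f z - P f z)) \<le> (\<Sum>m=1..n. C * q ^ m)"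
        by (intro sum_mono unit f)
      also have "\<dots> \<le> (\<Sum>m<Suc n. C * q ^ m)"
        using C q by (intro sum_mono2) auto
      also have "\<dots> \<le> C / (1 - q)"
      proof -
        have "(\<Sum>m<Suc n. q ^ m) = (1 - q ^ Suc n) / (1 - q)"
          using q by (intro sum_gp_strict[THEN trans]) auto
        also have "\<dots> \<le> 1 / (1 - q)" using q by (intro divide_right_mono) auto
        finally show ?thesis
          using mult_left_mono[OF _ C, of "\<Sum>m<Suc n. q ^ m" "1 / (1 - q)"]
          by (simp add: sum_distrib_left del: sum.lessThan_Suc)
      qed
      finally have "hardy_norm p (\<lambda>z. \<Sum>m=1..n. (T ^^ m) f z - P f z) \<le> C / (1 - q)"
        using S by linarith
      then have "cmod (1 / of_nat n) * hardy_norm p (\<lambda>z. \<Sum>m=1..n. (T ^^ m) f z - P f z)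
          \<le> (C / (1 - q)) / real n"
        by (simp add: norm_divide divide_right_mono del: divide_divide_eq_left)
      then show ?thesis
        unfolding eq using hardy_space_cmult[OF p conjunct1[OF S], of "1 / of_nat n"] by linarith
    qed
    from op_norm_bounds[OF p this] show "0 \<le> D n" "D n \<le> (C / (1 - q)) / real n"
      unfolding D_def by auto
  qed
  have "D \<longlonglongrightarrow> 0"
  proof (rule tendsto_sandwich)
    show "\<forall>\<^sub>F n in sequentially. 0 \<le> D n" "\<forall>\<^sub>F n in sequentially. D n \<le> (C / (1 - q)) / real n"
      using D by (auto intro!: eventually_sequentiallyI[of 1])
  qed (intro tendsto_const lim_const_over_n)+
  then show "uniformly_mean_ergodic (hardy_space p) (hardy_norm p) T"
    unfolding uniformly_mean_ergodic_def D_def using P by blast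
qed

lemma cmod_jet_0_le:
  assumes p: "1 \<le> p" and f: "f \<in> hardy_space p"
  shows "cmod (f 0) \<le> 3 * hardy_norm p f" "cmod (deriv f 0) \<le> 6 * hardy_norm p f"
proof -
  have f_le: "cmod (f z) \<le> 3 * hardy_norm p f" if "cmod z \<le> 1 / 2" for z
    using cmod_le_hardy_mean[OF p hardy_space_holo[OF f] that] hardy_mean_le_norm[OF f, of "3 / 4"] by simp
  then show "cmod (f 0) \<le> 3 * hardy_norm p f" by simp
  have hol: "f holomorphic_on ball 0 1" using hardy_space_holo[OF f] by (simp add: holo_disc_def)
  have "cmod ((deriv ^^ 1) f 0) \<le> fact 1 * (3 * hardy_norm p f) / (1 / 2) ^ 1"
    by (rule Cauchy_inequality)
      (use f_le in \<open>auto intro!: holomorphic_on_subset[OF hol] holomorphic_on_imp_continuous_on\<close>)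
  then show "cmod (deriv f 0) \<le> 6 * hardy_norm p f" by simp
qed

lemma holo_disc_has_derivative_0:
  assumes "f \<in> holo_disc" shows "(f has_field_derivative deriv f 0) (at 0)"
  using assms by (intro holomorphic_derivI[of f "ball 0 1"]) (auto simp: holo_disc_def)

lemma bounded_holo_disc_hardy:
  assumes p: "1 \<le> p" and f: "f \<in> holo_disc" and "0 \<le> C" "\<And>z. cmod z < 1 \<Longrightarrow> cmod (f z) \<le> C"
  shows "f \<in> hardy_space p"
  using assms by (intro hardy_spaceI(1)[where B = C] hardy_mean_le_const) auto

text \<open>The value and the derivative at the origin are bounded functionals, so they would map a dense
  projective orbit to a dense set of pairs. But a pair in the image has first entry 0 or ratio at most
  \<open>M\<close>, and this excludes a neighbourhood of the pair \<open>(1, M + 1)\<close>, the jet of \<open>1 + (M + 1) * z\<close>.\<close>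

lemma not_supercyclic_if_jet_bounded:
  assumes p: "1 \<le> p" and T: "bounded_linear_op (hardy_space p) (hardy_norm p) T"
    and jet: "\<And>x. x \<in> hardy_space p \<Longrightarrow> \<exists>M\<ge>0. \<forall>n. (T ^^ n) x 0 = 0 \<or>
      cmod (deriv ((T ^^ n) x) 0) \<le> M * cmod ((T ^^ n) x 0)"
  shows "\<not> supercyclic (hardy_space p) (hardy_norm p) T"
proof
  assume "supercyclic (hardy_space p) (hardy_norm p) T"
  then obtain x where x: "x \<in> hardy_space p" and dense:
    "\<And>y e. y \<in> hardy_space p \<Longrightarrow> e > 0 \<Longrightarrow> \<exists>g\<in>projective_orbit T x. hardy_norm p (\<lambda>z. y z - g z) < e"
    by (auto simp: supercyclic_def)
  obtain M where M: "M \<ge> 0" "\<And>n. (T ^^ n) x 0 = 0 \<or> cmod (deriv ((T ^^ n) x) 0) \<le> M * cmod ((T ^^ n) x 0)"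
    using jet[OF x] by blast
  define y :: "complex \<Rightarrow> complex" where "y z = (if z \<in> ball 0 1 then 1 + of_real (M + 1) * z else 0)" for z
  have y_holo: "y \<in> holo_disc"
  proof -
    have "y holomorphic_on ball 0 1"
      by (rule holomorphic_transform[where f = "\<lambda>z. 1 + of_real (M + 1) * z"])
        (auto simp: y_def intro!: holomorphic_intros)
    then show ?thesis by (auto simp: holo_disc_def y_def)
  qed
  have "cmod (y z) \<le> 1 + (M + 1)" if "cmod z < 1" for z
  proof -
    have "cmod (y z) \<le> 1 + cmod (of_real (M + 1) * z)"
      using that norm_triangle_ineq[of 1 "of_real (M + 1) * z"] by (simp add: y_def)
    also have "cmod (of_real (M + 1) * z) \<le> M + 1"
      using that M(1) unfolding norm_mult by (intro order_trans[OF mult_left_le]) auto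
    finally show ?thesis by simp
  qed
  then have y: "y \<in> hardy_space p"
    using M(1) by (intro bounded_holo_disc_hardy[OF p y_holo, where C = "1 + (M + 1)"]) auto
  have y0: "y 0 = 1" by (simp add: y_def)
  have y'0: "(y has_field_derivative of_real (M + 1)) (at 0)"
    by (rule has_field_derivative_transform_within_open[where f = "\<lambda>z. 1 + of_real (M + 1) * z" and S = "ball 0 1"])
      (auto simp: y_def intro!: derivative_eq_intros)
  \<comment> \<open>The errors in value and derivative are at most \<open>3 * e\<close> and \<open>6 * e\<close>; this size forces \<open>u 0 \<noteq> 0\<close> and
    excludes the ratio \<open>M + 1\<close>.\<close>
  define e where "e = 1 / (6 * (M + 2))"
  have e: "e > 0" "6 * e * (M + 2) = 1" using M(1) by (auto simp: e_def)
  obtain c n where g: "hardy_norm p (\<lambda>z. y z - c * (T ^^ n) x z) < e"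
    using dense[OF y e(1)] by (auto simp: projective_orbit_def)
  define u where "u = (T ^^ n) x"
  have u: "u \<in> hardy_space p" unfolding u_def by (rule bounded_linear_op_funpow(1)[OF T x])
  have d: "(\<lambda>z. y z - c * u z) \<in> hardy_space p"
    by (intro hardy_space_diff(1) hardy_space_cmult(1) p y u)
  have "deriv (\<lambda>z. y z - c * u z) 0 = of_real (M + 1) - c * deriv u 0"
    by (intro DERIV_imp_deriv DERIV_diff y'0 DERIV_cmult holo_disc_has_derivative_0 hardy_space_holo[OF u])
  then have 1: "cmod (of_real (M + 1) - c * deriv u 0) \<le> 6 * e"
    using cmod_jet_0_le(2)[OF p d] g by (simp add: u_def)
  have 2: "cmod (1 - c * u 0) \<le> 3 * e"
    using cmod_jet_0_le(1)[OF p d] g y0 by (simp add: u_def)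
  have 3: "6 * e \<le> 1 / 2" using M(1) by (simp add: e_def field_simps)
  have "u 0 \<noteq> 0" using 2 3 e(1) by auto
  then have "cmod (deriv u 0) \<le> M * cmod (u 0)" using M(2)[of n] by (simp add: u_def)
  then have "cmod (c * deriv u 0) \<le> M * cmod (c * u 0)"
    unfolding norm_mult using mult_left_mono[of _ _ "cmod c"] by (fastforce simp: mult_ac)
  also have "\<dots> \<le> M * (1 + 3 * e)"
    using 2 norm_triangle_ineq2[of "c * u 0" 1] M(1) by (intro mult_left_mono) (auto simp: norm_minus_commute)
  finally have "cmod (c * deriv u 0) \<le> M + 3 * (e * M)" by (simp add: algebra_simps)
  moreover have "M + 1 - cmod (c * deriv u 0) \<le> 6 * e"
    using 1 M(1) norm_triangle_ineq2[of "of_real (M + 1)" "c * deriv u 0"]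
    by (metis abs_of_nonneg add_nonneg_nonneg norm_of_real order_trans zero_le_one)
  moreover have "6 * (e * M) + 12 * e = 1" using e(2) by (simp add: algebra_simps)
  ultimately show False using e(1) M(1) mult_nonneg_nonneg[of e M] by linarith
qed

section \<open>Multiplication and division by powers of the variable\<close>

lemma holo_disc_power_mult: "g \<in> holo_disc \<Longrightarrow> (\<lambda>z. z ^ k * g z) \<in> holo_disc"
  by (auto simp: holo_disc_def intro!: holomorphic_intros)

lemma hardy_space_power_mult:
  assumes p: "1 \<le> p" and g: "g \<in> hardy_space p"
  shows "(\<lambda>z. z ^ k * g z) \<in> hardy_space p" "hardy_norm p (\<lambda>z. z ^ k * g z) \<le> hardy_norm p g"
proof -
  have le: "hardy_mean p (\<lambda>z. z ^ k * g z) r \<le> hardy_norm p g" if r: "0 \<le> r" "r < 1" for r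
  proof -
    have "hardy_mean p (\<lambda>z. z ^ k * g z) r \<le> 1 * hardy_mean p g r"
    proof (rule hardy_mean_le_cmult[OF p _ _ r])
      fix z :: complex assume "cmod z = r"
      then show "cmod (z ^ k * g z) \<le> 1 * cmod (g z)"
        using r by (simp add: norm_mult norm_power mult_left_le_one_le power_le_one)
    qed (use g in \<open>auto intro: holo_disc_power_mult hardy_space_holo\<close>)
    then show ?thesis using hardy_mean_le_norm[OF g r] by simp
  qed
  from hardy_spaceI[OF holo_disc_power_mult[OF hardy_space_holo[OF g]] le]
  show "(\<lambda>z. z ^ k * g z) \<in> hardy_space p" "hardy_norm p (\<lambda>z. z ^ k * g z) \<le> hardy_norm p g" by auto
qed

text \<open>On circles of radius at least \<open>1 / 2\<close>, dividing by \<open>z\<close> costs a factor 2. On smaller circles the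
  quotient is controlled pointwise by its mean over the circle of radius \<open>3 / 4\<close>, to which the
  first bound applies.\<close>

lemma hardy_space_divide:
  assumes p: "1 \<le> p" and g: "g \<in> holo_disc" and f: "(\<lambda>z. z * g z) \<in> hardy_space p"
  shows "g \<in> hardy_space p" "hardy_norm p g \<le> 6 * hardy_norm p (\<lambda>z. z * g z)"
proof -
  let ?f = "\<lambda>z. z * g z"
  have f_nn: "0 \<le> hardy_norm p ?f" by (rule hardy_norm_nonneg[OF f])
  have outer: "hardy_mean p g r \<le> 2 * hardy_norm p ?f" if r: "1 / 2 \<le> r" "r < 1" for r
  proof -
    have "hardy_mean p g r \<le> 2 * hardy_mean p ?f r"
    proof (rule hardy_mean_le_cmult[OF p g hardy_space_holo[OF f]])
      fix z :: complex assume "cmod z = r"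
      then have "1 \<le> 2 * cmod z" using r by auto
      from mult_right_mono[OF this norm_ge_zero[of "g z"]]
      show "cmod (g z) \<le> 2 * cmod (z * g z)" by (simp add: norm_mult)
    qed (use r in auto)
    also have "\<dots> \<le> 2 * hardy_norm p ?f"
      using r by (intro mult_left_mono hardy_mean_le_norm[OF f]) auto
    finally show ?thesis .
  qed
  have inner: "cmod (g z) \<le> 6 * hardy_norm p ?f" if "cmod z \<le> 1 / 2" for z
    using cmod_le_hardy_mean[OF p g that] outer[of "3 / 4"] by simp
  have mean: "hardy_mean p g r \<le> 6 * hardy_norm p ?f" if r: "0 \<le> r" "r < 1" for r
  proof (cases "r \<le> 1 / 2")
    case True
    then show ?thesis using f_nn inner by (intro hardy_mean_le_const[OF p g r]) auto
  next
    case False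
    then show ?thesis using outer[of r] r f_nn by linarith
  qed
  from hardy_spaceI[OF g mean] show "g \<in> hardy_space p" "hardy_norm p g \<le> 6 * hardy_norm p ?f" by auto
qed

lemma holo_disc_divide_zero:
  assumes G: "G \<in> holo_disc" "G 0 = 0"
  shows "\<exists>h\<in>holo_disc. G = (\<lambda>z. z * h z)"
proof
  define h where "h z = (if z = 0 then deriv G 0 else (G z - G 0) / (z - 0))" for z
  have "h holomorphic_on ball 0 1"
    unfolding h_def by (rule pole_lemma_open) (use G in \<open>auto simp: holo_disc_def\<close>)
  then show "h \<in> holo_disc" using G by (auto simp: holo_disc_def h_def)
  show "G = (\<lambda>z. z * h z)" using G by (auto simp: h_def fun_eq_iff)
qed

section \<open>Eigenfunctions of the Cesaro operator\<close>

text \<open>The function \<open>z ^ k * pole_power t k z\<close> is the eigenfunction of the generalized Cesaro operator for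
  the eigenvalue \<open>1 / (k + 1)\<close>: the equation \<open>C\<^sub>t f = \<lambda> f\<close> amounts to
  \<open>\<lambda> * (z f)' = f / (1 - t z)\<close>. The case \<open>k = 0\<close> spans the fixed space.\<close>

definition pole_power :: "real \<Rightarrow> nat \<Rightarrow> complex \<Rightarrow> complex" where
  "pole_power t k z = (if z \<in> ball 0 1 then 1 / (1 - of_real t * z) ^ Suc k else 0)"

lemma pole_power_0 [simp]: "pole_power t k 0 = 1"
  by (simp add: pole_power_def)

lemma pole_power_holo:
  assumes t: "0 \<le> t" "t < 1" shows "pole_power t k \<in> holo_disc"
proof -
  have "pole_power t k holomorphic_on ball 0 1"
    by (rule holomorphic_transform[where f = "\<lambda>z. 1 / (1 - of_real t * z) ^ Suc k"])
      (use cesaro_kernel_bound(2)[OF t] in \<open>auto simp: pole_power_def intro!: holomorphic_intros\<close>)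
  then show ?thesis by (auto simp: holo_disc_def pole_power_def)
qed

lemma pole_power_hardy:
  assumes p: "1 \<le> p" and t: "0 \<le> t" "t < 1" shows "pole_power t k \<in> hardy_space p"
proof (rule bounded_holo_disc_hardy[OF p pole_power_holo[OF t]])
  fix z :: complex assume z: "cmod z < 1"
  have "(1 - t) ^ Suc k \<le> cmod (1 - of_real t * z) ^ Suc k"
    using cesaro_kernel_bound(1)[OF t z] t by (intro power_mono) auto
  moreover have "0 < (1 - t) ^ Suc k" using t by (intro zero_less_power) auto
  ultimately have "1 / cmod (1 - of_real t * z) ^ Suc k \<le> 1 / (1 - t) ^ Suc k"
    by (intro divide_left_mono mult_pos_pos) auto
  then show "cmod (pole_power t k z) \<le> 1 / (1 - t) ^ Suc k"
    using z unfolding pole_power_def by (simp add: norm_divide norm_power norm_mult del: power_Suc)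
qed (use t in simp)

text \<open>With \<open>c = t * z\<close>, the integrand \<open>s ^ k / (1 - c * s) ^ (k + 2)\<close> is the derivative of
  \<open>(s / (1 - c * s)) ^ (k + 1) / (k + 1)\<close>, because \<open>s / (1 - c * s)\<close> has derivative \<open>1 / (1 - c * s)\<^sup>2\<close>.\<close>

lemma weighted_mean_pole_power:
  assumes t: "0 \<le> t" "t < 1"
  shows "weighted_mean k t (pole_power t k) = (\<lambda>z. 1 / of_nat (Suc k) * pole_power t k z)"
proof
  fix z
  show "weighted_mean k t (pole_power t k) z = 1 / of_nat (Suc k) * pole_power t k z"
  proof (cases "cmod z < 1")
    case True
    define F where "F w = (1 / of_nat (Suc k)) * (w / (1 - of_real t * z * w)) ^ Suc k" for w :: complex
    have "((\<lambda>s. of_real s ^ k * (pole_power t k (of_real s * z) / (1 - of_real t * (of_real s * z))))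
        has_integral F (of_real 1) - F (of_real 0)) {0..1}"
    proof (rule fundamental_theorem_of_calculus)
      fix s :: real assume s: "s \<in> {0..1}"
      have lt: "cmod (of_real s * z) < 1" using s True norm_of_real_mult_less by auto
      define d where "d = 1 - of_real t * z * of_real s"
      have d: "d \<noteq> 0" "1 - of_real t * (of_real s * z) = d"
        using cesaro_kernel_bound(2)[OF t lt] by (auto simp: d_def mult_ac)
      have "((\<lambda>w. w / (1 - of_real t * z * w)) has_field_derivative 1 / d ^ 2) (at (of_real s))"
        using d(1) unfolding d_def
        by (auto intro!: derivative_eq_intros simp: power2_eq_square algebra_simps)
      from DERIV_cmult[OF DERIV_power[OF this, of "Suc k"], of "1 / of_nat (Suc k)"]
      have "(F has_field_derivative (of_real s / d) ^ k / d ^ 2) (at (of_real s))"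
        unfolding F_def by (rule DERIV_cong) (auto simp: d_def field_simps simp del: of_nat_Suc)
      also have "(of_real s / d) ^ k / d ^ 2
          = of_real s ^ k * (pole_power t k (of_real s * z) / (1 - of_real t * (of_real s * z)))"
        using lt d by (simp add: pole_power_def power_divide power2_eq_square)
      finally show "((\<lambda>s. F (of_real s)) has_vector_derivative
          of_real s ^ k * (pole_power t k (of_real s * z) / (1 - of_real t * (of_real s * z)))) (at s within {0..1})"
        by (rule has_vector_derivative_real_field)
    qed simp
    then show ?thesis
      using True by (simp add: weighted_mean_def F_def integral_unique pole_power_def power_divide del: of_nat_Suc)
  qed (simp add: weighted_mean_def pole_power_def)
qed

lemma gen_cesaro_eigenfunction:
  assumes t: "0 \<le> t" "t < 1"
  shows "gen_cesaro t (\<lambda>z. z ^ k * pole_power t k z) = (\<lambda>z. 1 / of_nat (Suc k) * (z ^ k * pole_power t k z))"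
  by (simp add: gen_cesaro_eq weighted_mean_power_mult weighted_mean_pole_power[OF t] mult_ac)

lemma gen_cesaro_bounded_linear:
  assumes p: "1 \<le> p" and t: "0 \<le> t" "t < 1"
  shows "bounded_linear_op (hardy_space p) (hardy_norm p) (gen_cesaro t)"
  unfolding bounded_linear_op_def gen_cesaro_eq
proof (intro conjI ballI allI exI)
  fix f assume f: "f \<in> hardy_space p"
  show "weighted_mean 0 t f \<in> hardy_space p" by (rule weighted_mean_hardy(1)[OF p t f])
  show "hardy_norm p (weighted_mean 0 t f) \<le> 1 / (1 - t) * hardy_norm p f"
    using weighted_mean_hardy(2)[OF p t f, of 0] by simp
qed (simp_all add: weighted_mean_add[OF t] weighted_mean_cmult hardy_space_holo)

lemma shift_cesaro_bounded_linear:
  assumes p: "1 \<le> p" and t: "0 \<le> t" "t < 1"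
  shows "bounded_linear_op (hardy_space p) (hardy_norm p) (shift_cesaro t)"
  unfolding bounded_linear_op_def shift_cesaro_eq
proof (intro conjI ballI allI exI)
  fix f assume f: "f \<in> hardy_space p"
  note W = weighted_mean_hardy[OF p t f, of 0]
  show "(\<lambda>z. z * weighted_mean 0 t f z) \<in> hardy_space p"
    using hardy_space_power_mult(1)[OF p W(1), of 1] by simp
  show "hardy_norm p (\<lambda>z. z * weighted_mean 0 t f z) \<le> 1 / (1 - t) * hardy_norm p f"
    using hardy_space_power_mult(2)[OF p W(1), of 1] W(2) by simp
qed (simp_all add: weighted_mean_add[OF t] weighted_mean_cmult hardy_space_holo distrib_left mult_ac)

lemma gen_cesaro_funpow_power_mult:
  "(gen_cesaro t ^^ n) (\<lambda>z. z ^ k * g z) = (\<lambda>z. z ^ k * (weighted_mean k t ^^ n) g z)"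
  by (induction n) (auto simp: gen_cesaro_eq weighted_mean_power_mult)

lemma weighted_mean_funpow:
  assumes p: "1 \<le> p" and t: "0 \<le> t" "t < 1" and g: "g \<in> hardy_space p"
  shows "(weighted_mean k t ^^ n) g \<in> hardy_space p \<and>
    hardy_norm p ((weighted_mean k t ^^ n) g) \<le> (1 / ((1 - t) * real (Suc k))) ^ n * hardy_norm p g"
proof (induction n)
  case (Suc n)
  let ?h = "(weighted_mean k t ^^ n) g" and ?q = "1 / ((1 - t) * real (Suc k))"
  have h: "?h \<in> hardy_space p" "hardy_norm p ?h \<le> ?q ^ n * hardy_norm p g" using Suc by auto
  have q: "0 \<le> ?q" using t by simp
  have "hardy_norm p (weighted_mean k t ?h) \<le> ?q * hardy_norm p ?h"
    using weighted_mean_hardy(2)[OF p t h(1), of k] by simp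
  also have "\<dots> \<le> ?q * (?q ^ n * hardy_norm p g)" by (rule mult_left_mono[OF h(2) q])
  finally show ?case using weighted_mean_hardy(1)[OF p t h(1)] by (simp add: mult_ac)
qed (use g in simp)

section \<open>Decay of the Cesaro iterates on functions vanishing at the origin\<close>

text \<open>Functions with a zero of order \<open>k\<close> are represented as \<open>z ^ k * g z\<close>, and the bound is in terms of the
  quotient \<open>g\<close>. In this form the passage from one order to the next is a single division by \<open>z\<close>.\<close>

definition cesaro_decay :: "real \<Rightarrow> real \<Rightarrow> nat \<Rightarrow> bool" where
  "cesaro_decay p t k \<longleftrightarrow>
     (\<exists>C\<ge>0. \<forall>g\<in>hardy_space p. \<forall>n.
        hardy_norm p ((gen_cesaro t ^^ n) (\<lambda>z. z ^ k * g z)) \<le> C * (1 / 2) ^ n * hardy_norm p g)"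

text \<open>On functions with a zero of high order the Cesaro operator acts as \<open>weighted_mean k t\<close>, whose norm is
  at most \<open>1 / ((1 - t) * (k + 1))\<close>, and so at most \<open>1 / 2\<close>.\<close>

lemma cesaro_decay_high_order:
  assumes p: "1 \<le> p" and t: "0 \<le> t" "t < 1" and k: "2 \<le> (1 - t) * real (Suc k)"
  shows "cesaro_decay p t k"
  unfolding cesaro_decay_def
proof (intro exI[of _ 1] conjI ballI allI)
  fix g n assume g: "g \<in> hardy_space p"
  let ?h = "(weighted_mean k t ^^ n) g"
  have h: "?h \<in> hardy_space p" "hardy_norm p ?h \<le> (1 / ((1 - t) * real (Suc k))) ^ n * hardy_norm p g"
    using weighted_mean_funpow[OF p t g] by auto
  have "hardy_norm p ((gen_cesaro t ^^ n) (\<lambda>z. z ^ k * g z)) \<le> hardy_norm p ?h"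
    unfolding gen_cesaro_funpow_power_mult by (rule hardy_space_power_mult(2)[OF p h(1)])
  also note h(2)
  also have "(1 / ((1 - t) * real (Suc k))) ^ n * hardy_norm p g \<le> (1 / 2) ^ n * hardy_norm p g"
    using t k hardy_norm_nonneg[OF g]
    by (intro mult_right_mono power_mono divide_left_mono mult_pos_pos) (auto simp del: of_nat_Suc)
  finally show "hardy_norm p ((gen_cesaro t ^^ n) (\<lambda>z. z ^ k * g z)) \<le> 1 * (1 / 2) ^ n * hardy_norm p g"
    by simp
qed simp

text \<open>One step of the expansion in eigenfunctions, written for the quotients by \<open>z ^ k\<close>: subtracting
  the multiple of the eigenfunction with the same leading coefficient raises the order of the zero by
  one, with control of the norms.\<close>

lemma split_off_eigenfunction:
  assumes p: "1 \<le> p" and t: "0 \<le> t" "t < 1" and g: "g \<in> hardy_space p"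
  obtains h where "h \<in> hardy_space p" "\<And>z. g z = g 0 * pole_power t k z + z * h z"
    "hardy_norm p h \<le> 6 * (1 + 3 * hardy_norm p (pole_power t k)) * hardy_norm p g"
proof -
  let ?e = "pole_power t k"
  note e = pole_power_hardy[OF p t, of k]
  define G where "G z = g z - g 0 * ?e z" for z
  have G: "G \<in> hardy_space p" "hardy_norm p G \<le> (1 + 3 * hardy_norm p ?e) * hardy_norm p g"
  proof -
    have "hardy_norm p G \<le> hardy_norm p g + cmod (g 0) * hardy_norm p ?e"
      unfolding G_def
      using hardy_space_diff(2)[OF p g hardy_space_cmult(1)[OF p e, of "g 0"]] hardy_space_cmult(2)[OF p e, of "g 0"]
      by linarith
    also have "\<dots> \<le> hardy_norm p g + (3 * hardy_norm p g) * hardy_norm p ?e"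
      by (intro add_left_mono mult_right_mono cmod_jet_0_le(1) p g hardy_norm_nonneg e)
    finally show "hardy_norm p G \<le> (1 + 3 * hardy_norm p ?e) * hardy_norm p g" by (simp add: algebra_simps)
    show "G \<in> hardy_space p"
      unfolding G_def by (intro hardy_space_diff(1) hardy_space_cmult(1) p g e)
  qed
  obtain h where h: "h \<in> holo_disc" "G = (\<lambda>z. z * h z)"
    using holo_disc_divide_zero[OF hardy_space_holo[OF G(1)]] by (auto simp: G_def)
  have "h \<in> hardy_space p" "hardy_norm p h \<le> 6 * hardy_norm p G"
    using hardy_space_divide[OF p h(1)] G(1) unfolding h(2) by auto
  then show thesis
  proof (intro that[of h])
    show "g z = g 0 * ?e z + z * h z" for z
      using fun_cong[OF h(2), of z] by (simp add: G_def algebra_simps)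
    show "hardy_norm p h \<le> 6 * (1 + 3 * hardy_norm p ?e) * hardy_norm p g"
      using \<open>hardy_norm p h \<le> 6 * hardy_norm p G\<close> G(2) unfolding mult.assoc by linarith
  qed
qed

lemma gen_cesaro_funpow_split:
  assumes p: "1 \<le> p" and t: "0 \<le> t" "t < 1" and h: "h \<in> hardy_space p"
  shows "(gen_cesaro t ^^ n) (\<lambda>z. z ^ k * (a * pole_power t k z + z * h z))
    = (\<lambda>z. (a * (1 / of_nat (Suc k)) ^ n) * (z ^ k * pole_power t k z)
        + (gen_cesaro t ^^ n) (\<lambda>z. z ^ Suc k * h z) z)"
proof -
  let ?u = "\<lambda>z. z ^ k * pole_power t k z" and ?v = "\<lambda>z. z ^ Suc k * h z"
  note T = gen_cesaro_bounded_linear[OF p t]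
  have u: "?u \<in> hardy_space p" by (rule hardy_space_power_mult(1)[OF p pole_power_hardy[OF p t]])
  have v: "?v \<in> hardy_space p" by (rule hardy_space_power_mult(1)[OF p h])
  have "(gen_cesaro t ^^ n) ?u = (\<lambda>z. (1 / of_nat (Suc k)) ^ n * ?u z)"
  proof (induction n)
    case (Suc n)
    have "gen_cesaro t (\<lambda>z. (1 / of_nat (Suc k)) ^ n * ?u z) = (\<lambda>z. (1 / of_nat (Suc k)) ^ n * gen_cesaro t ?u z)"
      unfolding gen_cesaro_eq by (rule weighted_mean_cmult)
    then show ?case
      using Suc by (simp add: gen_cesaro_eigenfunction[OF t] mult_ac del: of_nat_Suc)
  qed simp
  moreover have "(\<lambda>z. z ^ k * (a * pole_power t k z + z * h z)) = (\<lambda>z. a * ?u z + ?v z)"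
    by (simp add: algebra_simps)
  ultimately show ?thesis
    using bounded_linear_op_funpow(2)[OF T hardy_space_cmult(1)[OF p u, of a] v, of n]
      bounded_linear_op_funpow(3)[OF T u, of n a] by (simp add: mult_ac del: of_nat_Suc power_Suc)
qed

text \<open>For \<open>k \<ge> 1\<close> the eigenfunction component is multiplied by \<open>1 / (k + 1) \<le> 1 / 2\<close> at each step, and the
  remainder has a zero of order \<open>k + 1\<close>. For \<open>k = 0\<close> the eigenvalue is 1, so the descent stops at order 1.\<close>

lemma cesaro_decay_step:
  assumes p: "1 \<le> p" and t: "0 \<le> t" "t < 1" and k: "1 \<le> k" and decay: "cesaro_decay p t (Suc k)"
  shows "cesaro_decay p t k"
proof -
  let ?e = "pole_power t k"
  define E where "E = hardy_norm p ?e"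
  note e = pole_power_hardy[OF p t, of k]
  have E: "0 \<le> E" unfolding E_def by (rule hardy_norm_nonneg[OF e])
  note T = gen_cesaro_bounded_linear[OF p t]
  obtain C where C: "C \<ge> 0" "\<And>h n. h \<in> hardy_space p \<Longrightarrow>
      hardy_norm p ((gen_cesaro t ^^ n) (\<lambda>z. z ^ Suc k * h z)) \<le> C * (1 / 2) ^ n * hardy_norm p h"
    using decay unfolding cesaro_decay_def by blast
  show ?thesis
    unfolding cesaro_decay_def
  proof (intro exI[of _ "3 * E + C * (6 * (1 + 3 * E))"] conjI ballI allI)
    fix g n assume g: "g \<in> hardy_space p"
    obtain h where h: "h \<in> hardy_space p" "\<And>z. g z = g 0 * ?e z + z * h z"
      "hardy_norm p h \<le> 6 * (1 + 3 * E) * hardy_norm p g"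
      using split_off_eigenfunction[OF p t g] unfolding E_def by blast
    let ?T = "gen_cesaro t ^^ n" and ?u = "\<lambda>z. z ^ k * ?e z" and ?v = "\<lambda>z. z ^ Suc k * h z"
    have u: "?u \<in> hardy_space p" "hardy_norm p ?u \<le> E"
      unfolding E_def by (rule hardy_space_power_mult[OF p e])+
    have v: "?v \<in> hardy_space p" by (rule hardy_space_power_mult(1)[OF p h(1)])
    have eq: "?T (\<lambda>z. z ^ k * g z) = (\<lambda>z. (g 0 * (1 / of_nat (Suc k)) ^ n) * ?u z + ?T ?v z)"
      using gen_cesaro_funpow_split[OF p t h(1), of n k "g 0"] unfolding h(2)[symmetric] .
    have "hardy_norm p (?T (\<lambda>z. z ^ k * g z))
        \<le> cmod (g 0 * (1 / of_nat (Suc k)) ^ n) * hardy_norm p ?u + hardy_norm p (?T ?v)"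
      unfolding eq
      using hardy_space_add(2)[OF p hardy_space_cmult(1)[OF p u(1), of "g 0 * (1 / of_nat (Suc k)) ^ n"]
          bounded_linear_op_funpow(1)[OF T v, of n]]
        hardy_space_cmult(2)[OF p u(1), of "g 0 * (1 / of_nat (Suc k)) ^ n"] by linarith
    also have "\<dots> \<le> (3 * hardy_norm p g * (1 / 2) ^ n) * E + C * (1 / 2) ^ n * (6 * (1 + 3 * E) * hardy_norm p g)"
    proof (rule add_mono)
      have "(1 / real (Suc k)) ^ n \<le> (1 / 2) ^ n"
        using k by (intro power_mono divide_left_mono) auto
      moreover have "cmod (g 0) \<le> 3 * hardy_norm p g" by (rule cmod_jet_0_le(1)[OF p g])
      ultimately have "cmod (g 0 * (1 / of_nat (Suc k)) ^ n) \<le> 3 * hardy_norm p g * (1 / 2) ^ n"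
        using hardy_norm_nonneg[OF g] unfolding norm_mult norm_power norm_divide norm_of_nat norm_one
        by (intro mult_mono) auto
      then show "cmod (g 0 * (1 / of_nat (Suc k)) ^ n) * hardy_norm p ?u \<le> 3 * hardy_norm p g * (1 / 2) ^ n * E"
        using u hardy_norm_nonneg[OF u(1)] hardy_norm_nonneg[OF g] by (intro mult_mono) auto
      show "hardy_norm p (?T ?v) \<le> C * (1 / 2) ^ n * (6 * (1 + 3 * E) * hardy_norm p g)"
        by (rule order_trans[OF C(2)[OF h(1)] mult_left_mono[OF h(3)]]) (use C(1) in simp)
    qed
    also have "\<dots> = (3 * E + C * (6 * (1 + 3 * E))) * (1 / 2) ^ n * hardy_norm p g"
      by (simp add: algebra_simps)
    finally show "hardy_norm p (?T (\<lambda>z. z ^ k * g z)) \<le> (3 * E + C * (6 * (1 + 3 * E))) * (1 / 2) ^ n * hardy_norm p g" .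
  qed (use C E in simp)
qed

lemma cesaro_decay_order_1:
  assumes p: "1 \<le> p" and t: "0 \<le> t" "t < 1"
  shows "cesaro_decay p t 1"
proof -
  \<comment> \<open>An order so high that the norm on that subspace is at most \<open>1 / 2\<close>; from there descend to order 1.\<close>
  obtain m where m: "2 / (1 - t) \<le> real m" using real_arch_simple by blast
  have "2 \<le> (1 - t) * real (Suc (Suc m))"
    using m t by (simp add: field_simps)
  then have top: "cesaro_decay p t (Suc m)" by (rule cesaro_decay_high_order[OF p t])
  show ?thesis
  proof (rule inc_induct[of 1 "Suc m"])
    show "cesaro_decay p t (Suc m)" by (rule top)
  qed (use cesaro_decay_step[OF p t] in auto)
qed

section \<open>The generalized Cesaro operator\<close>

text \<open>Splitting off the fixed point \<open>1 / (1 - t * z)\<close> leaves a function that vanishes at the origin, and on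
  such functions the iterates decay. The limit projection is \<open>f \<mapsto> f(0) / (1 - t * z)\<close>.\<close>

lemma gen_cesaro_geometric_convergence:
  assumes p: "1 \<le> p" and t: "0 \<le> t" "t < 1"
  shows "\<exists>C\<ge>0. \<forall>f\<in>hardy_space p. \<forall>n.
    hardy_norm p (\<lambda>z. (gen_cesaro t ^^ n) f z - f 0 * pole_power t 0 z) \<le> C * (1 / 2) ^ n * hardy_norm p f"
proof -
  define E where "E = hardy_norm p (pole_power t 0)"
  note e = pole_power_hardy[OF p t, of 0]
  have E: "0 \<le> E" unfolding E_def by (rule hardy_norm_nonneg[OF e])
  note T = gen_cesaro_bounded_linear[OF p t]
  obtain C where C: "C \<ge> 0" "\<And>h n. h \<in> hardy_space p \<Longrightarrow>
      hardy_norm p ((gen_cesaro t ^^ n) (\<lambda>z. z ^ 1 * h z)) \<le> C * (1 / 2) ^ n * hardy_norm p h"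
    using cesaro_decay_order_1[OF p t] unfolding cesaro_decay_def by blast
  show ?thesis
  proof (intro exI[of _ "C * (6 * (1 + 3 * E))"] conjI ballI allI)
    fix f n assume f: "f \<in> hardy_space p"
    obtain h where h: "h \<in> hardy_space p" "\<And>z. f z = f 0 * pole_power t 0 z + z * h z"
      "hardy_norm p h \<le> 6 * (1 + 3 * E) * hardy_norm p f"
      using split_off_eigenfunction[OF p t f] unfolding E_def by blast
    have "(\<lambda>z. (gen_cesaro t ^^ n) f z - f 0 * pole_power t 0 z) = (gen_cesaro t ^^ n) (\<lambda>z. z ^ 1 * h z)"
      using gen_cesaro_funpow_split[OF p t h(1), of n 0 "f 0"]
      unfolding power_0 mult_1_left h(2)[symmetric] by (simp add: fun_eq_iff)
    then have "hardy_norm p (\<lambda>z. (gen_cesaro t ^^ n) f z - f 0 * pole_power t 0 z) \<le> C * (1 / 2) ^ n * hardy_norm p h"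
      using C(2)[OF h(1)] by simp
    also have "\<dots> \<le> C * (1 / 2) ^ n * (6 * (1 + 3 * E) * hardy_norm p f)"
      using C(1) by (intro mult_left_mono h(3)) auto
    finally show "hardy_norm p (\<lambda>z. (gen_cesaro t ^^ n) f z - f 0 * pole_power t 0 z)
        \<le> C * (6 * (1 + 3 * E)) * (1 / 2) ^ n * hardy_norm p f" by (simp add: mult_ac)
  qed (use C E in simp)
qed

lemma gen_cesaro_ergodic:
  assumes p: "1 \<le> p" and t: "0 \<le> t" "t < 1"
  shows "power_bounded (hardy_space p) (hardy_norm p) (gen_cesaro t)"
    and "uniformly_mean_ergodic (hardy_space p) (hardy_norm p) (gen_cesaro t)"
proof -
  note T = gen_cesaro_bounded_linear[OF p t] and e = pole_power_hardy[OF p t, of 0]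
  obtain C where C: "C \<ge> 0" "\<And>f n. f \<in> hardy_space p \<Longrightarrow>
    hardy_norm p (\<lambda>z. (gen_cesaro t ^^ n) f z - f 0 * pole_power t 0 z) \<le> C * (1 / 2) ^ n * hardy_norm p f"
    using gen_cesaro_geometric_convergence[OF p t] by blast
  have "bounded_linear_op (hardy_space p) (hardy_norm p) (\<lambda>f z. f 0 * pole_power t 0 z)"
    unfolding bounded_linear_op_def
  proof (intro conjI ballI allI exI)
    fix f assume f: "f \<in> hardy_space p"
    show "(\<lambda>z. f 0 * pole_power t 0 z) \<in> hardy_space p" by (rule hardy_space_cmult(1)[OF p e])
    have "hardy_norm p (\<lambda>z. f 0 * pole_power t 0 z) \<le> cmod (f 0) * hardy_norm p (pole_power t 0)"
      by (rule hardy_space_cmult(2)[OF p e])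
    also have "\<dots> \<le> 3 * hardy_norm p f * hardy_norm p (pole_power t 0)"
      by (intro mult_right_mono cmod_jet_0_le(1) p f hardy_norm_nonneg e)
    finally show "hardy_norm p (\<lambda>z. f 0 * pole_power t 0 z) \<le> 3 * hardy_norm p (pole_power t 0) * hardy_norm p f"
      by (simp add: mult_ac)
  qed (simp_all add: algebra_simps)
  from geometric_convergence_imp_ergodic[OF p T this _ _ C(1), of "1 / 2"] C(2)
  show "power_bounded (hardy_space p) (hardy_norm p) (gen_cesaro t)"
    and "uniformly_mean_ergodic (hardy_space p) (hardy_norm p) (gen_cesaro t)" by auto
qed

lemma weighted_mean_at_0: "weighted_mean k t f 0 = f 0 / of_nat (Suc k)"
proof -
  have "((\<lambda>s. of_real s ^ k :: complex) has_integral
      of_real 1 ^ Suc k / of_nat (Suc k) - of_real 0 ^ Suc k / of_nat (Suc k)) {0..1}"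
  proof (rule fundamental_theorem_of_calculus)
    fix s :: real
    have "((\<lambda>w. w ^ Suc k / of_nat (Suc k) :: complex) has_field_derivative of_real s ^ k) (at (of_real s))"
      by (auto intro!: derivative_eq_intros simp del: of_nat_Suc power_Suc)
    then show "((\<lambda>s. of_real s ^ Suc k / of_nat (Suc k) :: complex) has_vector_derivative of_real s ^ k) (at s within {0..1})"
      by (rule has_vector_derivative_real_field)
  qed simp
  then show ?thesis by (simp add: weighted_mean_def integral_unique del: of_nat_Suc)
qed

text \<open>Write \<open>x = x(0) / (1 - t * z) + z * h(z)\<close>. The first summand is fixed, and the second is sent to
  \<open>z * W(z)\<close> with \<open>W(0) = h(0) / 2 ^ n\<close>. So the value at 0 stays \<open>x(0)\<close> while the derivative stays within
  \<open>t * \<bar>x(0)\<bar> + \<bar>h(0)\<bar>\<close>: the eigenvalues 1 and \<open>1 / 2\<close> of the adjoint keep the orbit from being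
  projectively dense.\<close>

lemma gen_cesaro_not_supercyclic:
  assumes p: "1 \<le> p" and t: "0 \<le> t" "t < 1"
  shows "\<not> supercyclic (hardy_space p) (hardy_norm p) (gen_cesaro t)"
proof (rule not_supercyclic_if_jet_bounded[OF p gen_cesaro_bounded_linear[OF p t]])
  fix x assume x: "x \<in> hardy_space p"
  obtain h where h: "h \<in> hardy_space p" "\<And>z. x z = x 0 * pole_power t 0 z + z * h z"
    using split_off_eigenfunction[OF p t x] by blast
  \<comment> \<open>If \<open>x 0 = 0\<close>, the quotient has the default value 0, and all values at the origin vanish.\<close>
  define M where "M = t + cmod (h 0) / cmod (x 0)"
  have "(gen_cesaro t ^^ n) x 0 = 0 \<or> cmod (deriv ((gen_cesaro t ^^ n) x) 0) \<le> M * cmod ((gen_cesaro t ^^ n) x 0)" for n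
  proof -
    define W where "W m = (weighted_mean 1 t ^^ m) h" for m
    have eq: "(gen_cesaro t ^^ n) x = (\<lambda>z. x 0 * pole_power t 0 z + z * W n z)"
      using gen_cesaro_funpow_split[OF p t h(1), of n 0 "x 0"] gen_cesaro_funpow_power_mult[of n t 1 h]
      unfolding power_0 mult_1_left h(2)[symmetric] by (simp add: fun_eq_iff W_def)
    have W0: "cmod (W m 0) \<le> cmod (h 0)" for m
    proof (induction m)
      case (Suc m)
      have "cmod (W (Suc m) 0) = cmod (W m 0) / 2"
        by (simp add: W_def weighted_mean_at_0 norm_divide)
      then show ?case using Suc norm_ge_zero[of "W m 0"] by linarith
    qed (simp add: W_def)
    have "W n \<in> hardy_space p" using weighted_mean_funpow[OF p t h(1)] by (simp add: W_def)
    then have W': "(W n has_field_derivative deriv (W n) 0) (at 0)"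
      by (intro holo_disc_has_derivative_0 hardy_space_holo)
    have e': "(pole_power t 0 has_field_derivative of_real t) (at 0)"
      by (rule has_field_derivative_transform_within_open[where f = "\<lambda>z. 1 / (1 - of_real t * z)" and S = "ball 0 1"])
        (auto simp: pole_power_def intro!: derivative_eq_intros)
    have "((gen_cesaro t ^^ n) x has_field_derivative x 0 * of_real t + W n 0) (at 0)"
      unfolding eq by (rule derivative_eq_intros e' W' refl)+ simp
    then have "deriv ((gen_cesaro t ^^ n) x) 0 = x 0 * of_real t + W n 0"
      by (rule DERIV_imp_deriv)
    then have "cmod (deriv ((gen_cesaro t ^^ n) x) 0) \<le> cmod (x 0) * t + cmod (h 0)"
      using norm_triangle_ineq[of "x 0 * of_real t" "W n 0"] W0[of n] t by (simp add: norm_mult)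
    moreover have "(gen_cesaro t ^^ n) x 0 = x 0" unfolding eq by simp
    moreover have "M * cmod (x 0) = cmod (x 0) * t + cmod (h 0)" if "x 0 \<noteq> 0"
      using that by (simp add: M_def distrib_right)
    ultimately show ?thesis by (cases "x 0 = 0") auto
  qed
  moreover have "0 \<le> M" using t by (simp add: M_def)
  ultimately show "\<exists>M\<ge>0. \<forall>n. (gen_cesaro t ^^ n) x 0 = 0 \<or>
      cmod (deriv ((gen_cesaro t ^^ n) x) 0) \<le> M * cmod ((gen_cesaro t ^^ n) x 0)" by blast
qed

section \<open>The shifted operator\<close>

text \<open>Each application raises the order of the zero at the origin by one, so the \<open>n\<close>-th application has
  norm at most \<open>1 / ((1 - t) * n)\<close> on the functions that it meets; the factors \<open>1 / n\<close> accumulate to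
  \<open>1 / fact n\<close>.\<close>

lemma shift_cesaro_funpow:
  assumes p: "1 \<le> p" and t: "0 \<le> t" "t < 1" and f: "f \<in> hardy_space p"
  shows "\<exists>g\<in>hardy_space p. (shift_cesaro t ^^ n) f = (\<lambda>z. z ^ n * g z) \<and>
    hardy_norm p g \<le> (1 / (1 - t)) ^ n / fact n * hardy_norm p f"
proof (induction n)
  case 0
  show ?case using f by (intro bexI[of _ f]) auto
next
  case (Suc n)
  then obtain g where g: "g \<in> hardy_space p" "(shift_cesaro t ^^ n) f = (\<lambda>z. z ^ n * g z)"
    "hardy_norm p g \<le> (1 / (1 - t)) ^ n / fact n * hardy_norm p f" by blast
  have "hardy_norm p (weighted_mean n t g) \<le> 1 / ((1 - t) * real (Suc n)) * hardy_norm p g"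
    using weighted_mean_hardy(2)[OF p t g(1), of n] by simp
  also have "\<dots> \<le> 1 / ((1 - t) * real (Suc n)) * ((1 / (1 - t)) ^ n / fact n * hardy_norm p f)"
    using t by (intro mult_left_mono g(3)) auto
  also have "\<dots> = (1 / (1 - t)) ^ Suc n / fact (Suc n) * hardy_norm p f"
    by (simp add: mult_ac del: of_nat_Suc)
  finally have "hardy_norm p (weighted_mean n t g) \<le> (1 / (1 - t)) ^ Suc n / fact (Suc n) * hardy_norm p f" .
  moreover have "(shift_cesaro t ^^ Suc n) f = (\<lambda>z. z ^ Suc n * weighted_mean n t g z)"
    by (simp add: g(2) shift_cesaro_eq weighted_mean_power_mult mult.assoc)
  ultimately show ?case
    using weighted_mean_hardy(1)[OF p t g(1), of n] by blast
qed

text \<open>The factorial beats every geometric sequence, so the powers tend to 0 geometrically and the limit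
  operator is 0.\<close>

lemma shift_cesaro_ergodic:
  assumes p: "1 \<le> p" and t: "0 \<le> t" "t < 1"
  shows "power_bounded (hardy_space p) (hardy_norm p) (shift_cesaro t)"
    and "uniformly_mean_ergodic (hardy_space p) (hardy_norm p) (shift_cesaro t)"
proof -
  note T = shift_cesaro_bounded_linear[OF p t]
  define K where "K = 1 / (1 - t)"
  \<comment> \<open>The factor 2 leaves room for the rate \<open>1 / 2\<close>.\<close>
  have "(\<lambda>n. inverse (fact n) * (2 * K) ^ n) \<longlonglongrightarrow> 0"
    by (rule summable_LIMSEQ_zero[OF summable_exp])
  then have "Bseq (\<lambda>n. inverse (fact n) * (2 * K) ^ n)"
    by (intro convergent_imp_Bseq convergentI)
  then obtain C where C: "C > 0" "\<And>n. \<bar>inverse (fact n) * (2 * K) ^ n\<bar> \<le> C"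
    by (auto simp: Bseq_def)
  have conv: "hardy_norm p (\<lambda>z. (shift_cesaro t ^^ n) f z - 0) \<le> C * (1 / 2) ^ n * hardy_norm p f"
    if f: "f \<in> hardy_space p" for f n
  proof -
    obtain g where g: "g \<in> hardy_space p" "(shift_cesaro t ^^ n) f = (\<lambda>z. z ^ n * g z)"
      "hardy_norm p g \<le> K ^ n / fact n * hardy_norm p f"
      using shift_cesaro_funpow[OF p t f, of n, folded K_def] by blast
    have "2 * K * (1 / 2) = K" by simp
    then have "K ^ n = (2 * K) ^ n * (1 / 2) ^ n"
      using power_mult_distrib[of "2 * K" "1 / 2" n] by metis
    then have "K ^ n / fact n = (inverse (fact n) * (2 * K) ^ n) * (1 / 2) ^ n"
      by (metis divide_inverse mult.assoc mult.commute)
    also have "\<dots> \<le> C * (1 / 2) ^ n"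
      using C(2)[of n] by (intro mult_right_mono) auto
    finally have "K ^ n / fact n * hardy_norm p f \<le> C * (1 / 2) ^ n * hardy_norm p f"
      by (intro mult_right_mono hardy_norm_nonneg f)
    then show ?thesis
      using hardy_space_power_mult(2)[OF p g(1), of n] g(2,3) by simp
  qed
  have "bounded_linear_op (hardy_space p) (hardy_norm p) (\<lambda>f z. 0)"
    unfolding bounded_linear_op_def by (auto simp: hardy_space_zero[OF p] intro!: exI[of _ 0])
  from geometric_convergence_imp_ergodic[OF p T this _ _ less_imp_le[OF C(1)], of "1 / 2"] conv
  show "power_bounded (hardy_space p) (hardy_norm p) (shift_cesaro t)"
    and "uniformly_mean_ergodic (hardy_space p) (hardy_norm p) (shift_cesaro t)" by auto
qed

text \<open>From the first application on, everything in the orbit vanishes at the origin; the only other direction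
  in the projective orbit is that of \<open>x\<close> itself, with a fixed jet.\<close>

lemma shift_cesaro_not_supercyclic:
  assumes p: "1 \<le> p" and t: "0 \<le> t" "t < 1"
  shows "\<not> supercyclic (hardy_space p) (hardy_norm p) (shift_cesaro t)"
proof (rule not_supercyclic_if_jet_bounded[OF p shift_cesaro_bounded_linear[OF p t]])
  fix x
  have "(shift_cesaro t ^^ n) x 0 = 0 \<or>
      cmod (deriv ((shift_cesaro t ^^ n) x) 0) \<le> cmod (deriv x 0) / cmod (x 0) * cmod ((shift_cesaro t ^^ n) x 0)" for n
    by (cases n) (auto simp: shift_cesaro_eq)
  then show "\<exists>M\<ge>0. \<forall>n. (shift_cesaro t ^^ n) x 0 = 0 \<or>
      cmod (deriv ((shift_cesaro t ^^ n) x) 0) \<le> M * cmod ((shift_cesaro t ^^ n) x 0)"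
    by (intro exI[of _ "cmod (deriv x 0) / cmod (x 0)"]) auto
qed

theorem proposition3p13:
  fixes p t :: real
  assumes "1 \<le> p" and "0 \<le> t" and "t < 1"
  shows "(bounded_linear_op (hardy_space p) (hardy_norm p) (gen_cesaro t) \<and>
          power_bounded (hardy_space p) (hardy_norm p) (gen_cesaro t) \<and>
          uniformly_mean_ergodic (hardy_space p) (hardy_norm p) (gen_cesaro t) \<and>
          \<not> supercyclic (hardy_space p) (hardy_norm p) (gen_cesaro t)) \<and>
         (bounded_linear_op (hardy_space p) (hardy_norm p) (shift_cesaro t) \<and>
          power_bounded (hardy_space p) (hardy_norm p) (shift_cesaro t) \<and>
          uniformly_mean_ergodic (hardy_space p) (hardy_norm p) (shift_cesaro t) \<and>
          \<not> supercyclic (hardy_space p) (hardy_norm p) (shift_cesaro t))"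
  by (intro conjI gen_cesaro_bounded_linear gen_cesaro_ergodic gen_cesaro_not_supercyclic
      shift_cesaro_bounded_linear shift_cesaro_ergodic shift_cesaro_not_supercyclic assms)

end
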